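(* Let $(X(t))$ be an irreducible and transient Markov chain on a countable set $E$ with substochastic transition matrix $P=(p(x,y))_{x,y\in E}$. Assume that $E$ is a subset of a group $(\mathcal E,\star)$, that $(E,\star)$ is a semigroup containing the identity element $e$, and that $p(x\star u,y\star u)\ge p(x,y)$ for all $x,y,u\in E$. Let $(H_n)$ be the ladder height process relative to $(X(t))$, $\mathcal T_\vartheta=\inf\{n\ge0:H_n=\vartheta\}$, and let $V(x)=\mathbb E_x(\mathcal T_\vartheta)$ for $x\in E$, $V(\vartheta)=0$. Then: (i) The ladder height process $(H_n)$ is transient on $E$. (ii) The function $V$ is finite, $V(e)=1$, and $$V(x\star u)=V(x)+GA_uV(x),\qquad\forall x,u\in E.$$ (iii) If $\mathbb E_x(\tau_\vartheta)=+\infty$ for all $x\in E$, then $V$ is harmonic for $(X(t))$ and for any $x\in E$ $$\lim_{n\to\infty}\frac{\mathbb P_x(\tau_\vartheta>n)}{\mathbb P_e(\tau_\vartheta>n)}=V(x).$$ (iv) If $\mathbb E_x(\tau_\vartheta)<+\infty$ for all $x\in E$, then $V$ is a potential function for $(X(t))$ and for any $x\in E$ $$V(x)=\frac{\mathbb E_x(\tau_\vartheta)}{\mathbb E_e(\tau_\vartheta)}\le\liminf_{n\to\infty}\frac{\mathbb P_x(\tau_\vartheta>n)}{\mathbb P_e(\tau_\vartheta>n)}.$$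
   Context: Irreducible: for all $x,y\in E$ there is $n\ge1$ with $\mathbb P_x(X(n)=y)>0$. The chain is completed by an absorbing state $\vartheta\notin E$ with $p(x,\vartheta)=1-\sum_{y\in E}p(x,y)$, and $\tau_\vartheta=\inf\{t\ge1:X(t)=\vartheta\}$. By irreducibility $x\mapsto\mathbb E_x(\tau_\vartheta)$ is either finite everywhere or infinite everywhere on $E$. Green function: $G(x,y)=\sum_{t\ge0}\mathbb P_x(X(t)=y)$, $x,y\in E$; $G\varphi(x)=\sum_{y\in E}G(x,y)\varphi(y)$ and $P\varphi(x)=\sum_{y\in E}p(x,y)\varphi(y)$ for $\varphi\ge0$. A harmonic function is a non-zero $h:E\to[0,\infty)$ with $Ph=h$; a potential function is a function $g:E\to[0,\infty)$ of the form $g=G\varphi$ with $\varphi:E\to[0,\infty)$. For $u\in E$, $A_u\varphi(x)=\sum_{y\in E}a_u(x,y)\varphi(y)$, where $a_u(x,y)=p(x\star u,y)-p(x,y\star u^{-1})$ if $y\in E\star u$ and $a_u(x,y)=p(x\star u,y)$ if $y\in E\setminus(E\star u)$; these coefficients are non-negative. The ladder height process $(H_n)$ is the Markov chain on $E\cup\{\vartheta\}$ with transition probabilities $p_H(x,y)=GA_x\mathbf 1_{\{y\}}(e)=\sum_{z\in E}G(e,z)a_x(z,y)$ for $x,y\in E$ (this matrix is substochastic), $p_H(x,\vartheta)=1-\sum_{y\in E}p_H(x,y)$, and $\vartheta$ absorbing. Its transience on $E$ means $\sum_{n\ge0}\mathbb P_x(H_n=y)<\infty$ for all $x,y\in E$.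 *)

theory Defs
  imports "HOL-Probability.Probability" "HOL-Algebra.Coset"
begin

text \<open>
  Nonnegative quantities that may a priori be infinite (Green functions, expectations,
  functions on which operators act) are \<^typ>\<open>ennreal\<close>-valued; being a function into
  $[0,\infty)$ is then a separate finiteness condition. All functions and matrices are
  only ever inspected on the state space \<open>E\<close>. The cemetery state is \<^term>\<open>None\<close>, and a
  state \<open>x \<in> E\<close> becomes \<^term>\<open>Some x\<close> in the completed state space.
\<close>

definition substochastic :: "'a set \<Rightarrow> ('a \<Rightarrow> 'a \<Rightarrow> real) \<Rightarrow> bool" where
  "substochastic E p \<longleftrightarrow>
     (\<forall>x\<in>E. (\<forall>y\<in>E. 0 \<le> p x y) \<and> p x summable_on E \<and> (\<Sum>\<^sub>\<infinity>y\<in>E. p x y) \<le> 1)"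

abbreviation completed :: "'a set \<Rightarrow> 'a option set" where
  "completed E \<equiv> insert None (Some ` E)"

fun completed_kernel ::
    "'a set \<Rightarrow> ('a \<Rightarrow> 'a \<Rightarrow> real) \<Rightarrow> 'a option \<Rightarrow> 'a option \<Rightarrow> real" where
  "completed_kernel E p (Some x) (Some y) = p x y"
| "completed_kernel E p (Some x) None = 1 - (\<Sum>\<^sub>\<infinity>y\<in>E. p x y)"
| "completed_kernel E p None (Some y) = 0"
| "completed_kernel E p None None = 1"

text \<open>
  \<open>M x\<close> is the law \<open>P\<^sub>x\<close> of the chain started at \<open>x \<in> E\<close>. The last clause is the Markov
  property \<open>P\<^sub>x(X(n+1) = z | X(0) = s(0), \<dots>, X(n) = s(n)) = p(s(n), z)\<close>, multiplied out so
  that conditioning events of probability zero need no special treatment.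
\<close>

definition markov_chain ::
    "'a set \<Rightarrow> ('a \<Rightarrow> 'a \<Rightarrow> real) \<Rightarrow> ('a \<Rightarrow> 'w measure) \<Rightarrow> (nat \<Rightarrow> 'w \<Rightarrow> 'a option) \<Rightarrow> bool" where
  "markov_chain E p M X \<longleftrightarrow>
     (\<forall>x\<in>E. prob_space (M x)
        \<and> (\<forall>t. X t \<in> M x \<rightarrow>\<^sub>M count_space (completed E))
        \<and> (AE \<omega> in M x. X 0 \<omega> = Some x)
        \<and> (\<forall>n s. \<forall>z\<in>completed E. (\<forall>i\<le>n. s i \<in> completed E) \<longrightarrow>
             measure (M x) {\<omega> \<in> space (M x). (\<forall>i\<le>n. X i \<omega> = s i) \<and> X (Suc n) \<omega> = z}
             = measure (M x) {\<omega> \<in> space (M x). \<forall>i\<le>n. X i \<omega> = s i}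
               * completed_kernel E p (s n) z))"

definition irreducible_chain ::
    "'a set \<Rightarrow> ('a \<Rightarrow> 'w measure) \<Rightarrow> (nat \<Rightarrow> 'w \<Rightarrow> 'a option) \<Rightarrow> bool" where
  "irreducible_chain E M X \<longleftrightarrow>
     (\<forall>x\<in>E. \<forall>y\<in>E. \<exists>n\<ge>1. emeasure (M x) {\<omega> \<in> space (M x). X n \<omega> = Some y} > 0)"

definition green ::
    "('a \<Rightarrow> 'w measure) \<Rightarrow> (nat \<Rightarrow> 'w \<Rightarrow> 'a option) \<Rightarrow> 'a \<Rightarrow> 'a \<Rightarrow> ennreal" where
  "green M X x y = (\<Sum>t. emeasure (M x) {\<omega> \<in> space (M x). X t \<omega> = Some y})"

definition transient_chain ::
    "'a set \<Rightarrow> ('a \<Rightarrow> 'w measure) \<Rightarrow> (nat \<Rightarrow> 'w \<Rightarrow> 'a option) \<Rightarrow> bool" where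
  "transient_chain E M X \<longleftrightarrow> (\<forall>x\<in>E. \<forall>y\<in>E. green M X x y < \<infinity>)"

definition kernel_op ::
    "'a set \<Rightarrow> ('a \<Rightarrow> 'a \<Rightarrow> ennreal) \<Rightarrow> ('a \<Rightarrow> ennreal) \<Rightarrow> 'a \<Rightarrow> ennreal" where
  "kernel_op E k \<phi> x = (\<Sum>\<^sub>\<infinity>y\<in>E. k x y * \<phi> y)"

definition trans_op ::
    "'a set \<Rightarrow> ('a \<Rightarrow> 'a \<Rightarrow> real) \<Rightarrow> ('a \<Rightarrow> ennreal) \<Rightarrow> 'a \<Rightarrow> ennreal" where
  "trans_op E p = kernel_op E (\<lambda>x y. ennreal (p x y))"

definition green_op ::
    "'a set \<Rightarrow> ('a \<Rightarrow> 'w measure) \<Rightarrow> (nat \<Rightarrow> 'w \<Rightarrow> 'a option)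
       \<Rightarrow> ('a \<Rightarrow> ennreal) \<Rightarrow> 'a \<Rightarrow> ennreal" where
  "green_op E M X = kernel_op E (green M X)"

definition harmonic_function ::
    "'a set \<Rightarrow> ('a \<Rightarrow> 'a \<Rightarrow> real) \<Rightarrow> ('a \<Rightarrow> ennreal) \<Rightarrow> bool" where
  "harmonic_function E p h \<longleftrightarrow>
     (\<forall>x\<in>E. h x < \<infinity>) \<and> (\<exists>x\<in>E. h x \<noteq> 0) \<and> (\<forall>x\<in>E. trans_op E p h x = h x)"

definition potential_function ::
    "'a set \<Rightarrow> ('a \<Rightarrow> 'w measure) \<Rightarrow> (nat \<Rightarrow> 'w \<Rightarrow> 'a option) \<Rightarrow> ('a \<Rightarrow> ennreal) \<Rightarrow> bool" where
  "potential_function E M X g \<longleftrightarrow>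
     (\<forall>x\<in>E. g x < \<infinity>) \<and>
     (\<exists>\<phi>. (\<forall>x\<in>E. \<phi> x < \<infinity>) \<and> (\<forall>x\<in>E. g x = green_op E M X \<phi> x))"

definition shift_coeff ::
    "('a, 'b) monoid_scheme \<Rightarrow> 'a set \<Rightarrow> ('a \<Rightarrow> 'a \<Rightarrow> real) \<Rightarrow> 'a \<Rightarrow> 'a \<Rightarrow> 'a \<Rightarrow> real" where
  "shift_coeff \<G> E p u x y =
     (if y \<in> E #>\<^bsub>\<G>\<^esub> u then p (x \<otimes>\<^bsub>\<G>\<^esub> u) y - p x (y \<otimes>\<^bsub>\<G>\<^esub> inv\<^bsub>\<G>\<^esub> u)
      else p (x \<otimes>\<^bsub>\<G>\<^esub> u) y)"

text \<open>The next lemma shows that \<^const>\<open>ennreal\<close> does not truncate these coefficients below.\<close>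

lemma shift_coeff_nonneg:
  assumes "group \<G>" "submonoid E \<G>" "substochastic E p"
    and "\<And>x y u. x \<in> E \<Longrightarrow> y \<in> E \<Longrightarrow> u \<in> E \<Longrightarrow> p (x \<otimes>\<^bsub>\<G>\<^esub> u) (y \<otimes>\<^bsub>\<G>\<^esub> u) \<ge> p x y"
    and "u \<in> E" "x \<in> E" "y \<in> E"
  shows "0 \<le> shift_coeff \<G> E p u x y"
proof -
  interpret group \<G> by fact
  interpret submonoid E \<G> by fact
  show ?thesis
  proof (cases "y \<in> E #>\<^bsub>\<G>\<^esub> u")
    case True
    then obtain w where w: "w \<in> E" "y = w \<otimes>\<^bsub>\<G>\<^esub> u" by (auto simp: r_coset_def)
    then have "y \<otimes>\<^bsub>\<G>\<^esub> inv\<^bsub>\<G>\<^esub> u = w" using assms(5) by (simp add: m_assoc)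
    then show ?thesis using True w assms(4)[of x w u] assms(5,6) by (simp add: shift_coeff_def)
  next
    case False
    have "x \<otimes>\<^bsub>\<G>\<^esub> u \<in> E" using assms(5,6) by simp
    then show ?thesis using False assms(3,7) by (simp add: shift_coeff_def substochastic_def)
  qed
qed

definition shift_op ::
    "('a, 'b) monoid_scheme \<Rightarrow> 'a set \<Rightarrow> ('a \<Rightarrow> 'a \<Rightarrow> real) \<Rightarrow> 'a
       \<Rightarrow> ('a \<Rightarrow> ennreal) \<Rightarrow> 'a \<Rightarrow> ennreal" where
  "shift_op \<G> E p u = kernel_op E (\<lambda>x y. ennreal (shift_coeff \<G> E p u x y))"

text \<open>
  The value inside \<^const>\<open>enn2real\<close> is at most 1: summing over \<open>y\<close> gives
  \<open>\<Sum>\<^sub>z G(e,z) (k(z) - k(z \<star> x))\<close> with \<open>k(z) = p(z, \<vartheta>)\<close> the killing probability.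
\<close>

definition ladder_kernel ::
    "('a, 'b) monoid_scheme \<Rightarrow> 'a set \<Rightarrow> ('a \<Rightarrow> 'a \<Rightarrow> real)
       \<Rightarrow> ('a \<Rightarrow> 'w measure) \<Rightarrow> (nat \<Rightarrow> 'w \<Rightarrow> 'a option) \<Rightarrow> 'a \<Rightarrow> 'a \<Rightarrow> real" where
  "ladder_kernel \<G> E p M X x y =
     enn2real (green_op E M X (shift_op \<G> E p x (indicator {y})) \<one>\<^bsub>\<G>\<^esub>)"

text \<open>First time \<open>t \<ge> k\<close> at which the path is in the cemetery (\<open>\<infinity>\<close> if there is none).\<close>

definition absorption_time :: "nat \<Rightarrow> (nat \<Rightarrow> 'w \<Rightarrow> 'a option) \<Rightarrow> 'w \<Rightarrow> ennreal" where
  "absorption_time k X \<omega> = (INF t\<in>{t. k \<le> t \<and> X t \<omega> = None}. of_nat t)"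

definition mean_absorption_time ::
    "nat \<Rightarrow> ('a \<Rightarrow> 'w measure) \<Rightarrow> (nat \<Rightarrow> 'w \<Rightarrow> 'a option) \<Rightarrow> 'a \<Rightarrow> ennreal" where
  "mean_absorption_time k M X x = (\<integral>\<^sup>+ \<omega>. absorption_time k X \<omega> \<partial>M x)"

definition survival_prob ::
    "('a \<Rightarrow> 'w measure) \<Rightarrow> (nat \<Rightarrow> 'w \<Rightarrow> 'a option) \<Rightarrow> nat \<Rightarrow> 'a \<Rightarrow> ennreal" where
  "survival_prob M X n x =
     emeasure (M x) {\<omega> \<in> space (M x). absorption_time 1 X \<omega> > of_nat n}"

fun renewal_fn ::
    "('a \<Rightarrow> 'w measure) \<Rightarrow> (nat \<Rightarrow> 'w \<Rightarrow> 'a option) \<Rightarrow> 'a option \<Rightarrow> ennreal" where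
  "renewal_fn N H (Some x) = mean_absorption_time 0 N H x"
| "renewal_fn N H None = 0"

end

(*
Write T_u f(x) = f(x * u). The operator A_u is the commutator T_u P - P T_u. For l < 1 put
R_l = sum_n l^n P^n, g_l = R_l 1 and f_l = g_l / g_l(e). Applying T_u to g_l = 1 + l P g_l shows
that T_u g_l is the bounded solution h of h = 1 + l A_u g_l + l P h, hence
  T_u g_l = g_l + l R_l A_u g_l.
At the point e this reads f_l = 1 + Q_l f_l with Q_l f(u) = l R_l A_u f(e), and f_l is bounded, so
f_l = sum_n Q_l^n 1. Therefore f_l increases with l, and by monotone convergence its limit as
l -> 1 is sum_n Q_1^n 1 = V, since Q_1 is the ladder kernel. Irreducibility bounds f_l uniformly
in l, so V is finite; the shift identity for V and the two cases for E(tau) follow from the same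
limit in the equations for g_l.

The ratios r_n = P^n 1 / P^n 1(e) satisfy r_n(u) >= 1 + sum_{k<n} P^k A_u r_n(e), so by Fatou
liminf r_n is a supersolution of f = 1 + Q_1 f and dominates V. If V is harmonic, then
P^m r_n(e) <= 1 = P^m V(e) together with liminf r_n >= V forces limsup r_n <= V.
*)
theory Submission
  imports Defs
begin

section \<open>Countable kernels\<close>

text \<open>Makes monotone convergence and Tonelli available for unordered sums. Finite subsums are
  integrals of truncations; conversely, an infinite \<open>A\<close> is enumerated and every initial
  partial sum is a finite subsum.\<close>

lemma infsum_ennreal_eq_nn_integral:
  fixes f :: "'a \<Rightarrow> ennreal"
  assumes "countable A"
  shows "infsum f A = (\<integral>\<^sup>+x. f x \<partial>count_space A)"
proof (rule antisym)
  have "sum f F \<le> (\<integral>\<^sup>+x. f x \<partial>count_space A)" if "finite F" "F \<subseteq> A" for F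
  proof -
    have "sum f F = (\<integral>\<^sup>+x. f x * indicator F x \<partial>count_space A)"
      using that by (subst nn_integral_count_space'[where A=F]) auto
    also have "\<dots> \<le> (\<integral>\<^sup>+x. f x \<partial>count_space A)"
      by (intro nn_integral_mono) (auto simp: indicator_def)
    finally show ?thesis .
  qed
  then show "infsum f A \<le> (\<integral>\<^sup>+x. f x \<partial>count_space A)"
    by (subst nonneg_infsum_complete) (auto intro!: SUP_least)
  show "(\<integral>\<^sup>+x. f x \<partial>count_space A) \<le> infsum f A"
  proof (cases "finite A")
    case True
    then show ?thesis by (simp add: nn_integral_count_space_finite)
  next
    case False
    have bij: "bij_betw (from_nat_into A) UNIV A"
      by (rule bij_betw_from_nat_into[OF assms False])
    have "(\<integral>\<^sup>+x. f x \<partial>count_space A) = (\<Sum>n. f (from_nat_into A n))"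
      by (simp add: nn_integral_bij_count_space[OF bij, symmetric] nn_integral_count_space_nat)
    also have "\<dots> \<le> infsum f A"
    proof (rule suminf_le_const[OF summableI])
      fix n
      have "(\<Sum>i<n. f (from_nat_into A i)) = sum f (from_nat_into A ` {..<n})"
        using bij by (subst sum.reindex) (auto simp: bij_betw_def intro: inj_on_subset)
      also have "\<dots> \<le> infsum f A"
        using False by (subst nonneg_infsum_complete)
          (auto intro!: SUP_upper from_nat_into)
      finally show "(\<Sum>i<n. f (from_nat_into A i)) \<le> infsum f A" .
    qed
    finally show ?thesis .
  qed
qed

lemma ennreal_infsum_eq_nn_integral:
  assumes "countable A" "f summable_on A" "\<And>x. x \<in> A \<Longrightarrow> 0 \<le> f x"
  shows "ennreal (infsum f A) = (\<integral>\<^sup>+x. ennreal (f x) \<partial>count_space A)"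
proof -
  have "ennreal (infsum f A) = infsum (\<lambda>x. ennreal (f x)) A"
    using assms(2,3)
    by (subst infsum_nonneg_is_SUPREMUM_ennreal, simp, simp, subst nonneg_infsum_complete)
      (auto intro!: SUP_cong simp: sum_ennreal subset_eq)
  then show ?thesis using assms(1) by (simp add: infsum_ennreal_eq_nn_integral)
qed

lemma suminf_split_zero_prefix:
  fixes f :: "nat \<Rightarrow> ennreal"
  shows "(\<Sum>n. f n) = f 0 + (\<Sum>n. f (Suc n))"
  using suminf_offset[of f 1] summableI[of f] by simp

lemma ennreal_suminf_finite_tendsto_0:
  fixes f :: "nat \<Rightarrow> ennreal"
  assumes "(\<Sum>n. f n) < \<infinity>"
  shows "f \<longlonglongrightarrow> 0"
proof -
  have "f n < \<infinity>" for n
    using ennreal_suminf_lessD[OF assms] by simp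
  then have f: "ennreal (enn2real (f n)) = f n" for n
    by (simp add: ennreal_enn2real)
  have "(\<Sum>n. ennreal (enn2real (f n))) \<noteq> \<infinity>"
    unfolding f using assms by simp
  then have "summable (\<lambda>n. enn2real (f n))"
    by (intro summable_suminf_not_top) auto
  then have "(\<lambda>n. ennreal (enn2real (f n))) \<longlonglongrightarrow> ennreal 0"
    by (intro tendsto_ennrealI summable_LIMSEQ_zero)
  then show ?thesis by (simp add: f)
qed

text \<open>With \<open>j\<close> fixed in \<open>a j\<close> the power alone climbs to 1, and the
  index \<open>max i j\<close> then dominates both factors at once. This removes the discount
  factors in the limit l \<rightarrow> 1.\<close>

lemma SUP_powers_mult_eq:
  fixes l a :: "nat \<Rightarrow> ennreal"
  assumes "incseq l" "l \<longlonglongrightarrow> 1" "incseq a"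
  shows "(SUP i. l i ^ k * a i) = (SUP i. a i)"
proof (rule antisym)
  have le1: "l i \<le> 1" for i
    by (rule incseq_le[OF assms(1,2)])
  have "l i ^ k * a i \<le> 1 * a i" for i
    using power_mono_ennreal[OF le1, of i k] by (intro mult_right_mono) auto
  then show "(SUP i. l i ^ k * a i) \<le> (SUP i. a i)"
    by (intro SUP_mono) auto
  have pow: "(\<lambda>i. l i ^ k) \<longlonglongrightarrow> 1"
    by (induction k) (use tendsto_mult_ennreal[OF assms(2)] in fastforce)+
  have "a j \<le> (SUP i. l i ^ k * a i)" for j
  proof -
    have inc: "incseq (\<lambda>i. l i ^ k)"
      using assms(1) by (auto simp: incseq_def intro: power_mono_ennreal)
    then have "(SUP i. l i ^ k) = 1"
      using LIMSEQ_unique[OF LIMSEQ_SUP pow] by blast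
    then have "a j = (SUP i. l i ^ k * a j)"
      by (simp add: SUP_mult_right_ennreal[symmetric])
    also have "\<dots> \<le> (SUP i. l i ^ k * a i)"
    proof (rule SUP_mono)
      fix i
      have "l i ^ k * a j \<le> l (max i j) ^ k * a (max i j)"
        using inc assms(3) by (intro mult_mono) (auto simp: incseq_def)
      then show "\<exists>m\<in>UNIV. l i ^ k * a j \<le> l m ^ k * a m" by auto
    qed
    finally show ?thesis .
  qed
  then show "(SUP i. a i) \<le> (SUP i. l i ^ k * a i)"
    by (intro SUP_least)
qed

section \<open>Operators given by nonnegative kernels\<close>

locale countable_space =
  fixes E :: "'a set"
  assumes countable_E: "countable E"
begin

lemma kernel_op_eq: "kernel_op E k \<phi> x = (\<integral>\<^sup>+y. k x y * \<phi> y \<partial>count_space E)"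
  by (simp add: kernel_op_def infsum_ennreal_eq_nn_integral countable_E)

lemma kernel_op_mono:
  "(\<And>y. y \<in> E \<Longrightarrow> \<phi> y \<le> \<psi> y) \<Longrightarrow> kernel_op E k \<phi> x \<le> kernel_op E k \<psi> x"
  by (auto simp: kernel_op_eq intro!: nn_integral_mono mult_left_mono)

lemma kernel_op_kernel_mono:
  "(\<And>y. y \<in> E \<Longrightarrow> k x y \<le> l x y) \<Longrightarrow> kernel_op E k \<phi> x \<le> kernel_op E l \<phi> x"
  by (auto simp: kernel_op_eq intro!: nn_integral_mono mult_right_mono)

lemma kernel_op_cong:
  "(\<And>y. y \<in> E \<Longrightarrow> \<phi> y = \<psi> y) \<Longrightarrow> kernel_op E k \<phi> x = kernel_op E k \<psi> x"
  by (auto simp: kernel_op_eq intro!: nn_integral_cong)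

lemma kernel_op_add:
  "kernel_op E k (\<lambda>y. \<phi> y + \<psi> y) x = kernel_op E k \<phi> x + kernel_op E k \<psi> x"
  by (auto simp: kernel_op_eq nn_integral_add distrib_left)

lemma kernel_op_zero: "kernel_op E k (\<lambda>y. 0) x = 0"
  by (simp add: kernel_op_eq)

lemma kernel_op_cmult: "kernel_op E k (\<lambda>y. c * \<phi> y) x = c * kernel_op E k \<phi> x"
  by (subst (1 2) kernel_op_eq, subst nn_integral_cmult[symmetric]) (auto simp: ac_simps)

lemma kernel_op_sum:
  "kernel_op E k (\<lambda>y. \<Sum>i\<in>I. \<phi> i y) x = (\<Sum>i\<in>I. kernel_op E k (\<phi> i) x)"
  by (induction I rule: infinite_finite_induct) (auto simp: kernel_op_zero kernel_op_add)

lemma kernel_op_SUP: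
  assumes "\<And>y. y \<in> E \<Longrightarrow> incseq (\<lambda>i. \<phi> i y)"
  shows "kernel_op E k (\<lambda>y. SUP i. \<phi> i y) x = (SUP i. kernel_op E k (\<phi> i) x)"
proof -
  have "kernel_op E k (\<lambda>y. SUP i. \<phi> i y) x
      = (\<integral>\<^sup>+y. (SUP i. k x y * \<phi> i y * indicator E y) \<partial>count_space UNIV)"
    by (simp add: kernel_op_eq SUP_mult_left_ennreal SUP_mult_right_ennreal nn_integral_count_space_indicator)
  also have "\<dots> = (SUP i. \<integral>\<^sup>+y. k x y * \<phi> i y * indicator E y \<partial>count_space UNIV)"
    using assms by (intro nn_integral_monotone_convergence_SUP)
      (auto simp: incseq_def le_fun_def indicator_def intro!: mult_left_mono)
  finally show ?thesis
    by (simp add: kernel_op_eq nn_integral_count_space_indicator)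
qed

lemma kernel_op_indicator: "y \<in> E \<Longrightarrow> kernel_op E k (indicator {y}) x = k x y"
  by (simp add: kernel_op_eq)

lemma kernel_op_point_le: "y \<in> E \<Longrightarrow> k x y * \<phi> y \<le> kernel_op E k \<phi> x"
  unfolding kernel_op_eq by (rule nn_integral_ge_point)

lemma kernel_op_comp:
  "kernel_op E k (kernel_op E l \<phi>) x
     = kernel_op E (\<lambda>x y. kernel_op E k (\<lambda>z. l z y) x) \<phi> x"
proof -
  have "kernel_op E k (kernel_op E l \<phi>) x
      = (\<integral>\<^sup>+z. \<integral>\<^sup>+y. k x z * (l z y * \<phi> y) \<partial>count_space E \<partial>count_space E)"
    by (simp add: kernel_op_eq nn_integral_cmult)
  also have "\<dots> = (\<integral>\<^sup>+y. \<integral>\<^sup>+z. k x z * (l z y * \<phi> y) \<partial>count_space E \<partial>count_space E)"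
    by (rule nn_integral_count_space_nn_integral) (auto simp: countable_E)
  also have "\<dots> = kernel_op E (\<lambda>x y. kernel_op E k (\<lambda>z. l z y) x) \<phi> x"
    by (simp add: kernel_op_eq nn_integral_multc[symmetric] mult.assoc)
  finally show ?thesis .
qed

lemma funpow_kernel_mono:
  assumes "\<And>y. y \<in> E \<Longrightarrow> \<phi> y \<le> \<psi> y" "x \<in> E"
  shows "(kernel_op E k ^^ n) \<phi> x \<le> (kernel_op E k ^^ n) \<psi> x"
  using assms(2) by (induction n arbitrary: x) (auto intro!: kernel_op_mono assms(1))

lemma funpow_kernel_cong:
  assumes "\<And>y. y \<in> E \<Longrightarrow> \<phi> y = \<psi> y" "x \<in> E"
  shows "(kernel_op E k ^^ n) \<phi> x = (kernel_op E k ^^ n) \<psi> x"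
  by (intro antisym funpow_kernel_mono) (use assms in auto)

text \<open>Lets iterates inherit additivity, scaling and monotone convergence from single kernels,
  with no separate induction for each property.\<close>

lemma funpow_kernel_repr:
  assumes "x \<in> E"
  shows "(kernel_op E k ^^ n) \<phi> x = kernel_op E (\<lambda>x y. (kernel_op E k ^^ n) (indicator {y}) x) \<phi> x"
  using assms
proof (induction n arbitrary: x)
  case 0
  have "kernel_op E (\<lambda>x y. indicator {y} x) \<phi> x = (\<integral>\<^sup>+y. \<phi> y * indicator {x} y \<partial>count_space E)"
    unfolding kernel_op_eq by (intro nn_integral_cong) (auto simp: indicator_def)
  with 0 show ?case by simp
next
  case (Suc n)
  have "(kernel_op E k ^^ Suc n) \<phi> x
      = kernel_op E k (kernel_op E (\<lambda>x y. (kernel_op E k ^^ n) (indicator {y}) x) \<phi>) x"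
    by (auto simp: Suc.IH intro!: kernel_op_cong)
  then show ?case by (simp add: kernel_op_comp)
qed

lemma funpow_kernel_SUP:
  assumes "\<And>y. y \<in> E \<Longrightarrow> incseq (\<lambda>i. \<phi> i y)" "x \<in> E"
  shows "(kernel_op E k ^^ n) (\<lambda>y. SUP i. \<phi> i y) x = (SUP i. (kernel_op E k ^^ n) (\<phi> i) x)"
  by (simp add: funpow_kernel_repr[OF assms(2), of n k] kernel_op_SUP[OF assms(1)])

lemma funpow_kernel_cmult:
  assumes "x \<in> E"
  shows "(kernel_op E k ^^ n) (\<lambda>y. c * \<phi> y) x = c * (kernel_op E k ^^ n) \<phi> x"
  by (simp add: funpow_kernel_repr[OF assms, of n k] kernel_op_cmult)

lemma funpow_kernel_add:
  assumes "x \<in> E"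
  shows "(kernel_op E k ^^ n) (\<lambda>y. \<phi> y + \<psi> y) x = (kernel_op E k ^^ n) \<phi> x + (kernel_op E k ^^ n) \<psi> x"
  by (simp add: funpow_kernel_repr[OF assms, of n k] kernel_op_add)

lemma funpow_scaled_kernel:
  assumes "x \<in> E"
  shows "(kernel_op E (\<lambda>x y. c * k x y) ^^ n) \<phi> x = c ^ n * (kernel_op E k ^^ n) \<phi> x"
  using assms
proof (induction n arbitrary: x)
  case (Suc n)
  have "(kernel_op E (\<lambda>x y. c * k x y) ^^ Suc n) \<phi> x
      = kernel_op E (\<lambda>x y. c * k x y) (\<lambda>y. c ^ n * (kernel_op E k ^^ n) \<phi> y) x"
    by (auto simp: Suc.IH intro!: kernel_op_cong)
  also have "\<dots> = c ^ n * (c * kernel_op E k ((kernel_op E k ^^ n) \<phi>) x)"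
    by (subst kernel_op_cmult, subst (1 2) kernel_op_eq, subst nn_integral_cmult[symmetric])
      (auto simp: ac_simps)
  finally show ?case by (simp add: ac_simps)
qed simp

section \<open>Neumann series and minimal solutions of f = b + q f\<close>

lemma fixpoint_iterate:
  assumes "\<And>x. x \<in> E \<Longrightarrow> f x = b x + kernel_op E q f x" "x \<in> E"
  shows "f x = (\<Sum>i<n. (kernel_op E q ^^ i) b x) + (kernel_op E q ^^ n) f x"
  using assms(2)
proof (induction n arbitrary: x)
  case (Suc n)
  have "f x = b x + kernel_op E q f x" by (rule assms(1)[OF Suc.prems])
  also have "kernel_op E q f x
      = kernel_op E q (\<lambda>y. (\<Sum>i<n. (kernel_op E q ^^ i) b y) + (kernel_op E q ^^ n) f y) x"
    by (rule kernel_op_cong) (rule Suc.IH)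
  finally show ?case
    by (simp add: kernel_op_add kernel_op_sum add.assoc
        sum.lessThan_Suc_shift del: sum.lessThan_Suc)
qed simp

lemma fixpoint_eq_suminf:
  assumes "\<And>x. x \<in> E \<Longrightarrow> f x = b x + kernel_op E q f x" "x \<in> E"
    and "(\<lambda>n. (kernel_op E q ^^ n) f x) \<longlonglongrightarrow> 0"
  shows "f x = (\<Sum>n. (kernel_op E q ^^ n) b x)"
proof -
  have "(\<lambda>n. (\<Sum>i<n. (kernel_op E q ^^ i) b x) + (kernel_op E q ^^ n) f x)
      \<longlonglongrightarrow> (\<Sum>n. (kernel_op E q ^^ n) b x) + 0"
    by (intro tendsto_add summable_LIMSEQ summableI assms)
  moreover have "(\<Sum>i<n. (kernel_op E q ^^ i) b x) + (kernel_op E q ^^ n) f x = f x" for n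
    by (rule fixpoint_iterate[symmetric]) (fact assms)+
  ultimately have "(\<lambda>n. f x) \<longlonglongrightarrow> (\<Sum>n. (kernel_op E q ^^ n) b x) + 0"
    by (simp only:)
  then show ?thesis by (simp add: LIMSEQ_const_iff)
qed

text \<open>Positivity of the kernel keeps each partial sum of the Neumann series below
  \<open>f\<close>. This minimality gives lower bounds both for \<open>renewal\<close> and for the
  limit inferior of the survival ratios.\<close>

lemma supersolution_ge_suminf:
  assumes "\<And>x. x \<in> E \<Longrightarrow> b x + kernel_op E q f x \<le> f x" "x \<in> E"
  shows "(\<Sum>n. (kernel_op E q ^^ n) b x) \<le> f x"
proof (rule suminf_le_const[OF summableI])
  fix n
  show "(\<Sum>i<n. (kernel_op E q ^^ i) b x) \<le> f x"
    using assms(2)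
  proof (induction n arbitrary: x)
    case (Suc n)
    have "(\<Sum>i<Suc n. (kernel_op E q ^^ i) b x)
        = b x + kernel_op E q (\<lambda>y. \<Sum>i<n. (kernel_op E q ^^ i) b y) x"
      by (simp add: kernel_op_sum sum.lessThan_Suc_shift del: sum.lessThan_Suc)
    also have "\<dots> \<le> b x + kernel_op E q f x"
      using Suc.IH by (intro add_left_mono kernel_op_mono)
    also have "\<dots> \<le> f x" by (rule assms(1)[OF Suc.prems])
    finally show ?case .
  qed simp
qed

text \<open>No contraction is available, so the remainder is controlled by the source itself: the
  Neumann series of 1 lies below the finite value \<open>f x\<close>, hence its terms tend to 0, and
  \<open>f \<le> B\<close> bounds the remainder by \<open>B\<close> times such a term.\<close>

lemma bounded_fixpoint_one_eq_suminf:
  assumes fix_eq: "\<And>x. x \<in> E \<Longrightarrow> f x = 1 + kernel_op E q f x"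
    and bound: "\<And>x. x \<in> E \<Longrightarrow> f x \<le> B" and "B < \<infinity>" "x \<in> E"
  shows "f x = (\<Sum>n. (kernel_op E q ^^ n) (\<lambda>_. 1) x)"
proof (rule fixpoint_eq_suminf[OF fix_eq \<open>x \<in> E\<close>])
  have "(\<Sum>n. (kernel_op E q ^^ n) (\<lambda>_. 1) x) \<le> f x"
    by (intro supersolution_ge_suminf \<open>x \<in> E\<close> eq_refl fix_eq[symmetric])
  also have "f x < \<infinity>" using bound[OF \<open>x \<in> E\<close>] \<open>B < \<infinity>\<close> by (rule le_less_trans)
  finally have "(\<lambda>n. (kernel_op E q ^^ n) (\<lambda>_. 1) x) \<longlonglongrightarrow> 0"
    by (rule ennreal_suminf_finite_tendsto_0)
  then have "(\<lambda>n. B * (kernel_op E q ^^ n) (\<lambda>_. 1) x) \<longlonglongrightarrow> B * 0"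
    using \<open>B < \<infinity>\<close> by (intro tendsto_intros) auto
  then have lim: "(\<lambda>n. B * (kernel_op E q ^^ n) (\<lambda>_. 1) x) \<longlonglongrightarrow> 0" by simp
  have le: "(kernel_op E q ^^ n) f x \<le> B * (kernel_op E q ^^ n) (\<lambda>_. 1) x" for n
  proof -
    have "(kernel_op E q ^^ n) f x \<le> (kernel_op E q ^^ n) (\<lambda>_. B * 1) x"
      using bound by (intro funpow_kernel_mono \<open>x \<in> E\<close>) simp
    also have "\<dots> = B * (kernel_op E q ^^ n) (\<lambda>_. 1) x"
      by (rule funpow_kernel_cmult[OF \<open>x \<in> E\<close>])
    finally show ?thesis .
  qed
  show "(\<lambda>n. (kernel_op E q ^^ n) f x) \<longlonglongrightarrow> 0"
    by (rule tendsto_sandwich[OF _ _ tendsto_const lim]) (simp_all add: le)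
qed

lemma kernel_op_suminf:
  "kernel_op E k (\<lambda>y. \<Sum>n. \<phi> n y) x = (\<Sum>n. kernel_op E k (\<phi> n) x)"
  by (simp add: kernel_op_eq nn_integral_suminf flip: ennreal_suminf_cmult)

lemma funpow_kernel_kernel_mono:
  assumes "\<And>x y. x \<in> E \<Longrightarrow> y \<in> E \<Longrightarrow> k x y \<le> l x y" "x \<in> E"
  shows "(kernel_op E k ^^ n) \<phi> x \<le> (kernel_op E l ^^ n) \<phi> x"
  using assms(2)
proof (induction n arbitrary: x)
  case (Suc n)
  have "kernel_op E k ((kernel_op E k ^^ n) \<phi>) x \<le> kernel_op E l ((kernel_op E k ^^ n) \<phi>) x"
    using assms(1) Suc.prems by (intro kernel_op_kernel_mono) auto
  also have "\<dots> \<le> kernel_op E l ((kernel_op E l ^^ n) \<phi>) x"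
    by (intro kernel_op_mono Suc.IH)
  finally show ?case by simp
qed simp

end

section \<open>The renewal function\<close>

locale right_monotone_kernel = countable_space E + group G + submonoid E G
  for E :: "'a set" and G (structure) +
  fixes p :: "'a \<Rightarrow> 'a \<Rightarrow> real"
  assumes substoch: "substochastic E p"
    and right_mono: "\<And>x y u. x \<in> E \<Longrightarrow> y \<in> E \<Longrightarrow> u \<in> E \<Longrightarrow> p (x \<otimes> u) (y \<otimes> u) \<ge> p x y"
    and irreducible: "\<And>x y. x \<in> E \<Longrightarrow> y \<in> E \<Longrightarrow> \<exists>n\<ge>1. 0 < (trans_op E p ^^ n) (indicator {y}) x"
begin

abbreviation P :: "('a \<Rightarrow> ennreal) \<Rightarrow> 'a \<Rightarrow> ennreal" where
  "P \<equiv> kernel_op E (\<lambda>x y. ennreal (p x y))"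

abbreviation A :: "'a \<Rightarrow> ('a \<Rightarrow> ennreal) \<Rightarrow> 'a \<Rightarrow> ennreal" where
  "A u \<equiv> kernel_op E (\<lambda>x y. ennreal (shift_coeff G E p u x y))"

text \<open>This is P_x(\<tau> > n) in matrix form; \<open>survival_prob_eq\<close> makes the link,
  so that the present locale involves no path measure.\<close>

definition survival :: "nat \<Rightarrow> 'a \<Rightarrow> ennreal" where
  "survival n = (P ^^ n) (\<lambda>_. 1)"

lemma p_nonneg: "x \<in> E \<Longrightarrow> y \<in> E \<Longrightarrow> 0 \<le> p x y"
  using substoch by (simp add: substochastic_def)

lemma P_const_one_le: "x \<in> E \<Longrightarrow> P (\<lambda>_. 1) x \<le> 1"
  using substoch countable_E
  by (auto simp: kernel_op_eq substochastic_def simp flip: ennreal_infsum_eq_nn_integral)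

lemma survival_0 [simp]: "survival 0 x = 1"
  by (simp add: survival_def)

lemma survival_Suc: "survival (Suc n) = P (survival n)"
  by (simp add: survival_def)

lemma survival_Suc_le: "x \<in> E \<Longrightarrow> survival (Suc n) x \<le> survival n x"
proof (induction n arbitrary: x)
  case 0
  then show ?case using P_const_one_le by (simp add: survival_def)
next
  case (Suc n)
  then show ?case by (subst (1 2) survival_Suc) (intro kernel_op_mono)
qed

lemma survival_antimono: "x \<in> E \<Longrightarrow> m \<le> n \<Longrightarrow> survival n x \<le> survival m x"
  by (rule decseqD) (auto simp: decseq_Suc_iff survival_Suc_le)

lemma survival_le_1: "x \<in> E \<Longrightarrow> survival n x \<le> 1"
  using survival_antimono[of x 0 n] by simp

text \<open>If no \<open>y\<close> in \<open>E\<close> had \<open>p x y > 0\<close>, every positive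
  power of \<open>P\<close> would vanish at \<open>x\<close>, against irreducibility. Moving to such
  a \<open>y\<close> first carries the induction.\<close>

lemma survival_pos:
  assumes "x \<in> E"
  shows "0 < survival n x"
  using assms
proof (induction n arbitrary: x)
  case (Suc n)
  obtain m where "0 < (P ^^ Suc m) (indicator {x}) x"
    using irreducible[OF Suc.prems Suc.prems] by (auto simp: trans_op_def Suc_le_eq gr0_conv_Suc)
  then obtain y where "y \<in> E" "0 < p x y"
  proof (rule contrapos_pp)
    assume "\<not> thesis"
    then have "P ((P ^^ m) (indicator {x})) x = P (\<lambda>_. 0) x"
      using that unfolding kernel_op_eq
      by (intro nn_integral_cong) (force simp: ennreal_eq_0_iff not_less)
    then show "\<not> 0 < (P ^^ Suc m) (indicator {x}) x"
      by (simp add: kernel_op_zero)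
  qed
  then have "0 < ennreal (p x y) * survival n y"
    using Suc.IH[of y] by (simp add: ennreal_zero_less_mult_iff)
  also have "\<dots> \<le> survival (Suc n) x"
    unfolding survival_Suc by (rule kernel_op_point_le) fact
  finally show ?case .
qed simp

text \<open>Take \<open>c\<close> to be the probability of being at \<open>y\<close> at a time
  \<open>m\<close> where it is positive. Surviving \<open>n\<close> further steps from
  \<open>y\<close> means surviving \<open>m + n\<close> steps from \<open>x\<close>. Since
  \<open>c\<close> does not depend on \<open>n\<close>, the comparison passes to every
  \<open>g l\<close> with one constant.\<close>

lemma survival_harnack:
  assumes "x \<in> E" "y \<in> E"
  obtains c where "0 < c" "c \<le> 1" "\<And>n. c * survival n y \<le> survival n x"
proof -
  obtain m where m: "0 < (P ^^ m) (indicator {y}) x"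
    using irreducible[OF assms] by (auto simp: trans_op_def)
  show thesis
  proof (rule that[OF m])
    have "(P ^^ m) (indicator {y}) x \<le> survival m x"
      unfolding survival_def by (intro funpow_kernel_mono assms) (auto simp: indicator_def)
    also have "\<dots> \<le> 1" by (rule survival_le_1[OF assms(1)])
    finally show "(P ^^ m) (indicator {y}) x \<le> 1" .
    fix n
    have "(P ^^ m) (indicator {y}) x * survival n y \<le> (P ^^ m) (survival n) x"
      unfolding funpow_kernel_repr[OF assms(1), of m _ "survival n"]
      by (rule kernel_op_point_le[OF assms(2)])
    also have "\<dots> = survival (m + n) x"
      by (simp add: survival_def funpow_add)
    also have "\<dots> \<le> survival n x"
      by (intro survival_antimono assms) simp
    finally show "(P ^^ m) (indicator {y}) x * survival n y \<le> survival n x" .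
  qed
qed

section \<open>Commutation of right translation with the kernel\<close>

text \<open>The row of \<open>x \<otimes> u\<close> is the row of \<open>x\<close> pushed forward by
  right translation onto the coset \<open>E #> u\<close>, plus a remainder, nonnegative on the coset
  by \<open>right_mono\<close>, that is the row of \<open>A u\<close>. The substitution
  \<open>y = w \<otimes> u\<close> then rewrites the first part.\<close>

lemma P_right_shift:
  assumes x: "x \<in> E" and u: "u \<in> E"
  shows "P \<phi> (x \<otimes> u) = P (\<lambda>y. \<phi> (y \<otimes> u)) x + A u \<phi> x"
proof -
  let ?b = "\<lambda>y. if y \<in> E #> u then ennreal (p x (y \<otimes> inv u)) else 0"
  have inv: "w \<otimes> u \<otimes> inv u = w" if "w \<in> E" for w
    using that u by (simp add: m_assoc)
  have split: "ennreal (p (x \<otimes> u) y) = ?b y + ennreal (shift_coeff G E p u x y)" if y: "y \<in> E" for y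
  proof (cases "y \<in> E #> u")
    case True
    then obtain w where w: "w \<in> E" "y = w \<otimes> u" by (auto simp: r_coset_def)
    then show ?thesis
      using True inv right_mono[OF x w(1) u] p_nonneg[OF x w(1)]
      by (simp add: shift_coeff_def flip: ennreal_plus)
  qed (simp add: shift_coeff_def)
  have bij: "bij_betw (\<lambda>w. w \<otimes> u) E (E #> u)"
    using inv by (intro bij_betwI[where g="\<lambda>y. y \<otimes> inv u"]) (auto simp: r_coset_def)
  have sub: "E #> u \<subseteq> E" using u by (auto simp: r_coset_def)
  have "(\<integral>\<^sup>+y. ?b y * \<phi> y \<partial>count_space E)
      = (\<integral>\<^sup>+y. ennreal (p x (y \<otimes> inv u)) * \<phi> y \<partial>count_space (E #> u))"
    using sub by (subst (1 2) nn_integral_count_space_indicator)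
      (auto intro!: nn_integral_cong simp: indicator_def)
  also have "\<dots> = (\<integral>\<^sup>+w. ennreal (p x (w \<otimes> u \<otimes> inv u)) * \<phi> (w \<otimes> u) \<partial>count_space E)"
    by (rule nn_integral_bij_count_space[OF bij, symmetric])
  also have "\<dots> = P (\<lambda>y. \<phi> (y \<otimes> u)) x"
    unfolding kernel_op_eq by (intro nn_integral_cong) (simp add: inv)
  finally have "(\<integral>\<^sup>+y. ?b y * \<phi> y \<partial>count_space E) = P (\<lambda>y. \<phi> (y \<otimes> u)) x" .
  moreover have "P \<phi> (x \<otimes> u)
      = (\<integral>\<^sup>+y. ?b y * \<phi> y + ennreal (shift_coeff G E p u x y) * \<phi> y \<partial>count_space E)"
    unfolding kernel_op_eq
    by (intro nn_integral_cong) (simp only: space_count_space split distrib_right)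
  then have "P \<phi> (x \<otimes> u) = (\<integral>\<^sup>+y. ?b y * \<phi> y \<partial>count_space E) + A u \<phi> x"
    by (simp add: nn_integral_add kernel_op_eq)
  ultimately show ?thesis by simp
qed

section \<open>Resolvents and discounted lifetimes\<close>

text \<open>Discounted Green operator; \<open>l = 1\<close> gives the Green operator itself, so one
  definition serves both sides of the limit l \<rightarrow> 1.\<close>

definition resolvent :: "ennreal \<Rightarrow> ('a \<Rightarrow> ennreal) \<Rightarrow> 'a \<Rightarrow> ennreal" where
  "resolvent l \<phi> x = (\<Sum>n. l ^ n * (P ^^ n) \<phi> x)"

lemma resolvent_scaled:
  "x \<in> E \<Longrightarrow> resolvent l \<phi> x = (\<Sum>n. (kernel_op E (\<lambda>x y. l * ennreal (p x y)) ^^ n) \<phi> x)"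
  by (simp add: resolvent_def funpow_scaled_kernel)

lemma resolvent_repr:
  assumes "x \<in> E"
  shows "resolvent l \<phi> x = kernel_op E (\<lambda>x y. resolvent l (indicator {y}) x) \<phi> x"
proof -
  have "resolvent l \<phi> x
      = (\<Sum>n. l ^ n * (\<integral>\<^sup>+y. (P ^^ n) (indicator {y}) x * \<phi> y \<partial>count_space E))"
    unfolding resolvent_def
    by (subst funpow_kernel_repr[OF assms]) (simp only: kernel_op_eq)
  also have "\<dots> = (\<integral>\<^sup>+y. (\<Sum>n. l ^ n * (P ^^ n) (indicator {y}) x * \<phi> y) \<partial>count_space E)"
    by (simp add: nn_integral_suminf nn_integral_cmult mult.assoc)
  finally show ?thesis
    by (subst kernel_op_eq) (simp add: resolvent_def)
qed

lemma resolvent_add: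
  "x \<in> E \<Longrightarrow> resolvent l (\<lambda>y. \<phi> y + \<psi> y) x = resolvent l \<phi> x + resolvent l \<psi> x"
  by (subst (1 2 3) resolvent_repr) (simp_all add: kernel_op_add)

lemma resolvent_cmult: "x \<in> E \<Longrightarrow> resolvent l (\<lambda>y. c * \<phi> y) x = c * resolvent l \<phi> x"
  by (subst (1 2) resolvent_repr) (simp_all add: kernel_op_cmult)

lemma resolvent_mono:
  assumes "\<And>y. y \<in> E \<Longrightarrow> \<phi> y \<le> \<psi> y" "l \<le> l'" "x \<in> E"
  shows "resolvent l \<phi> x \<le> resolvent l' \<psi> x"
  unfolding resolvent_def
  by (intro suminf_le summableI mult_mono power_mono_ennreal funpow_kernel_mono assms) auto

text \<open>\<open>n\<close> iterations of the equation leave a remainder at most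
  \<open>l ^ n * B\<close>, which vanishes for \<open>l < 1\<close>: bounded solutions are
  unique.\<close>

lemma resolvent_eqI:
  assumes "l < 1" "B < \<infinity>" "x \<in> E" and bound: "\<And>x. x \<in> E \<Longrightarrow> f x \<le> B"
    and eq: "\<And>x. x \<in> E \<Longrightarrow> f x = b x + l * P f x"
  shows "f x = resolvent l b x"
  unfolding resolvent_scaled[OF \<open>x \<in> E\<close>]
proof (rule fixpoint_eq_suminf[OF _ \<open>x \<in> E\<close>])
  show "f y = b y + kernel_op E (\<lambda>x y. l * ennreal (p x y)) f y" if "y \<in> E" for y
    using eq[OF that] funpow_scaled_kernel[OF that, of 1 l "\<lambda>x y. ennreal (p x y)" f] by simp
  have pow: "(\<lambda>n. l ^ n) \<longlonglongrightarrow> 0"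
  proof -
    from \<open>l < 1\<close> obtain r where r: "l = ennreal r" "0 \<le> r" "r < 1"
      by (cases l) auto
    then have "(\<lambda>n. ennreal (r ^ n)) \<longlonglongrightarrow> ennreal 0"
      by (intro tendsto_ennrealI LIMSEQ_power_zero) auto
    then show ?thesis using r by (simp add: ennreal_power)
  qed
  then have "(\<lambda>n. l ^ n * B) \<longlonglongrightarrow> 0 * B"
    using \<open>B < \<infinity>\<close> by (intro tendsto_mult_ennreal tendsto_const) auto
  then have lim: "(\<lambda>n. l ^ n * B) \<longlonglongrightarrow> 0" by simp
  have le: "(kernel_op E (\<lambda>x y. l * ennreal (p x y)) ^^ n) f x \<le> l ^ n * B" for n
  proof -
    have "(P ^^ n) f x \<le> (P ^^ n) (\<lambda>_. B * 1) x"
      using bound by (intro funpow_kernel_mono \<open>x \<in> E\<close>) simp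
    also have "\<dots> = B * survival n x"
      unfolding survival_def by (rule funpow_kernel_cmult[OF \<open>x \<in> E\<close>])
    also have "\<dots> \<le> B * 1"
      by (intro mult_left_mono survival_le_1 \<open>x \<in> E\<close>) simp
    finally show ?thesis
      by (simp add: funpow_scaled_kernel[OF \<open>x \<in> E\<close>] mult_left_mono)
  qed
  show "(\<lambda>n. (kernel_op E (\<lambda>x y. l * ennreal (p x y)) ^^ n) f x) \<longlonglongrightarrow> 0"
    by (rule tendsto_sandwich[OF _ _ tendsto_const lim]) (simp_all add: le)
qed

text \<open>Generating function of the survival probabilities; at \<open>l = 1\<close> it is the
  mean absorption time E_x(\<tau>), possibly infinite.\<close>

abbreviation g :: "ennreal \<Rightarrow> 'a \<Rightarrow> ennreal" where
  "g l \<equiv> resolvent l (\<lambda>_. 1)"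

lemma g_eq: "x \<in> E \<Longrightarrow> g l x = 1 + l * P (g l) x"
  unfolding resolvent_def
  by (subst suminf_split_zero_prefix)
    (simp add: kernel_op_suminf kernel_op_cmult mult.assoc flip: ennreal_suminf_cmult)

lemma g_eq_survival: "g l x = (\<Sum>n. l ^ n * survival n x)"
  by (simp add: resolvent_def survival_def)

lemma g_ge_1: "x \<in> E \<Longrightarrow> 1 \<le> g l x"
  by (subst g_eq) auto

lemma g_bounded:
  assumes "l < 1"
  obtains B where "B < \<infinity>" "\<And>x. x \<in> E \<Longrightarrow> g l x \<le> B"
proof
  from \<open>l < 1\<close> obtain r where r: "l = ennreal r" "0 \<le> r" "r < 1"
    by (cases l) auto
  have "(\<Sum>n. l ^ n) = (\<Sum>n. ennreal (r ^ n))"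
    using r by (simp add: ennreal_power)
  also have "\<dots> = ennreal (\<Sum>n. r ^ n)"
    using r by (intro suminf_ennreal2 summable_geometric) auto
  finally show "(\<Sum>n. l ^ n) < \<infinity>" by simp
  show "g l x \<le> (\<Sum>n. l ^ n)" if "x \<in> E" for x
    unfolding g_eq_survival using mult_left_mono[OF survival_le_1[OF that], of "l ^ n" for n]
    by (intro suminf_le summableI) simp
qed

lemma g_finite: "l < 1 \<Longrightarrow> x \<in> E \<Longrightarrow> g l x < \<infinity>"
  by (metis g_bounded le_less_trans)

lemma g_right_shift:
  assumes "l < 1" "x \<in> E" and u: "u \<in> E"
  shows "g l (x \<otimes> u) = g l x + l * resolvent l (A u (g l)) x"
proof -
  obtain B where B: "B < \<infinity>" "\<And>x. x \<in> E \<Longrightarrow> g l x \<le> B"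
    using g_bounded[OF \<open>l < 1\<close>] by blast
  \<comment> \<open>Commuting the translation past \<open>P\<close> turns the resolvent equation at
    \<open>y \<otimes> u\<close> into one for the translated function, with source
    \<open>1 + l * A u (g l) y\<close>.\<close>
  have "g l (y \<otimes> u) = (1 + l * A u (g l) y) + l * P (\<lambda>y. g l (y \<otimes> u)) y" if "y \<in> E" for y
    using that u by (subst g_eq) (simp_all add: P_right_shift distrib_left ac_simps)
  then have "g l (x \<otimes> u) = resolvent l (\<lambda>y. 1 + l * A u (g l) y) x"
    using u by (intro resolvent_eqI[where B=B and f="\<lambda>y. g l (y \<otimes> u)"] assms B) auto
  then show ?thesis
    by (simp add: resolvent_add resolvent_cmult \<open>x \<in> E\<close>)
qed

section \<open>Normalized potentials and their Neumann series\<close>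

text \<open>Dividing by the value at the identity keeps a finite limit even when \<open>g l\<close>
  diverges as l \<rightarrow> 1.\<close>

definition normalized :: "ennreal \<Rightarrow> 'a \<Rightarrow> ennreal" where
  "normalized l x = g l x / g l \<one>"

lemma normalized_eq: "normalized l = (\<lambda>x. inverse (g l \<one>) * g l x)"
  by (simp add: normalized_def divide_ennreal_def mult.commute fun_eq_iff)

lemma normalized_right_shift:
  assumes "l < 1" "x \<in> E" "u \<in> E"
  shows "normalized l (x \<otimes> u) = normalized l x + l * resolvent l (A u (normalized l)) x"
proof -
  have "A u (normalized l) = (\<lambda>y. inverse (g l \<one>) * A u (g l) y)"
    by (simp add: normalized_eq kernel_op_cmult fun_eq_iff)
  then show ?thesis
    by (simp add: normalized_eq g_right_shift assms resolvent_cmult distrib_left ac_simps)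
qed

lemma normalized_one: "l < 1 \<Longrightarrow> normalized l \<one> = 1"
  using g_finite[of l \<one>] g_ge_1[of \<one> l] by (auto simp: normalized_def intro!: ennreal_divide_self)

text \<open>The comparison constant for survival probabilities passes termwise through the series
  for \<open>g l\<close>; the resulting bound depends on \<open>x\<close> but not on
  \<open>l\<close>.\<close>

lemma normalized_le:
  assumes "x \<in> E" "l < 1"  and c: "0 < c" "c \<le> 1" "\<And>n. c * survival n x \<le> survival n \<one>"
  shows "normalized l x \<le> inverse c"
proof -
  have "c * g l x \<le> g l \<one>"
    unfolding g_eq_survival ennreal_suminf_cmult[symmetric]
    by (intro suminf_le summableI) (simp add: mult.left_commute[of c] mult_left_mono c(3))
  then have "inverse c * (c * g l x) \<le> inverse c * g l \<one>"
    by (intro mult_left_mono) auto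
  moreover have "inverse c * c = 1"
    using c(1) le_less_trans[OF c(2), of \<infinity>]
    by (subst mult.commute) (auto simp: divide_ennreal_def[symmetric] intro!: ennreal_divide_self)
  ultimately have "g l x \<le> inverse c * g l \<one>"
    by (simp add: mult.assoc[symmetric])
  then have "normalized l x \<le> inverse c * g l \<one> * inverse (g l \<one>)"
    by (simp add: normalized_def divide_ennreal_def mult_right_mono)
  moreover have "g l \<one> * inverse (g l \<one>) = 1"
    using normalized_one[OF \<open>l < 1\<close>] by (simp add: normalized_def divide_ennreal_def)
  ultimately show ?thesis by (simp add: mult.assoc)
qed

text \<open>Given as a kernel operator, so that the Neumann series lemmas apply; at
  \<open>l = 1\<close> the entries are those of the ladder matrix p_H. \<open>ladder_op_eq\<close>
  recovers the closed form.\<close>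

definition ladder_op :: "ennreal \<Rightarrow> ('a \<Rightarrow> ennreal) \<Rightarrow> 'a \<Rightarrow> ennreal" where
  "ladder_op l = kernel_op E (\<lambda>u y. l * resolvent l (A u (indicator {y})) \<one>)"

text \<open>Tonelli moves the sum over the target state outside. The parameter \<open>u\<close> of
  \<open>A u\<close> becomes the row index of the new kernel.\<close>

lemma ladder_op_eq: "ladder_op l \<phi> u = l * resolvent l (A u \<phi>) \<one>"
proof -
  let ?R = "\<lambda>x y. resolvent l (indicator {y}) x"
  have "resolvent l (A u \<phi>) \<one> = kernel_op E ?R (A u \<phi>) \<one>"
    by (rule resolvent_repr) simp
  also have "\<dots> = kernel_op E (\<lambda>x y. kernel_op E ?R (\<lambda>z. ennreal (shift_coeff G E p u z y)) x) \<phi> \<one>"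
    by (rule kernel_op_comp)
  also have "\<dots> = kernel_op E (\<lambda>x y. kernel_op E ?R (A u (indicator {y})) \<one>) \<phi> u"
    unfolding kernel_op_eq[of _ \<phi>]
    by (intro nn_integral_cong arg_cong2[where f=times] kernel_op_cong)
      (simp_all add: kernel_op_indicator)
  also have "\<dots> = kernel_op E (\<lambda>u y. resolvent l (A u (indicator {y})) \<one>) \<phi> u"
    unfolding kernel_op_eq[of _ \<phi>]
    by (intro nn_integral_cong) (simp add: resolvent_repr[of \<one>])
  finally have *: "resolvent l (A u \<phi>) \<one> = \<dots>" .
  show ?thesis
    unfolding * ladder_op_def
    by (subst (1 2) kernel_op_eq) (simp add: nn_integral_cmult[symmetric] mult.assoc)
qed

lemma normalized_fixpoint:
  assumes "l < 1" "u \<in> E"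
  shows "normalized l u = 1 + ladder_op l (normalized l) u"
  using normalized_right_shift[OF assms(1) one_closed assms(2)] normalized_one[OF assms(1)] assms(2)
  by (simp add: ladder_op_eq)

lemma normalized_eq_suminf:
  assumes "l < 1" "x \<in> E"
  shows "normalized l x = (\<Sum>n. (ladder_op l ^^ n) (\<lambda>_. 1) x)"
proof -
  obtain B where B: "B < \<infinity>" "\<And>x. x \<in> E \<Longrightarrow> g l x \<le> B"
    using g_bounded[OF \<open>l < 1\<close>] by blast
  \<comment> \<open>This bound is uniform over \<open>E\<close> but depends on \<open>l\<close>,
    opposite to \<open>normalized_le\<close>; it makes the remainder of the Neumann series
    vanish.\<close>
  have "inverse (g l \<one>) * B < \<infinity>"
    using B(1) g_ge_1[of \<one> l] by (auto simp: less_top[symmetric] ennreal_mult_eq_top_iff)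
  moreover have "normalized l x \<le> inverse (g l \<one>) * B" if "x \<in> E" for x
    unfolding normalized_eq using B(2)[OF that] by (intro mult_left_mono) auto
  ultimately show ?thesis
    unfolding ladder_op_def
    by (intro bounded_fixpoint_one_eq_suminf assms(2))
      (use normalized_fixpoint[OF assms(1)] in \<open>simp_all add: ladder_op_def\<close>)
qed

lemma ladder_op_funpow_mono:
  assumes "l \<le> l'" "x \<in> E"
  shows "(ladder_op l ^^ n) \<phi> x \<le> (ladder_op l' ^^ n) \<phi> x"
  unfolding ladder_op_def
  by (intro funpow_kernel_kernel_mono mult_mono resolvent_mono assms) auto

section \<open>Passage to the limit l = 1\<close>

text \<open>A concrete sequence in [1/2, 1) increasing to 1, so that the limit in \<open>l\<close>
  becomes a countable monotone one.\<close>

definition level :: "nat \<Rightarrow> ennreal" where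
  "level i = ennreal (1 - 1 / real (i + 2))"

lemma level_less_1: "level i < 1"
  unfolding level_def ennreal_1[symmetric] by (subst ennreal_less_iff) auto

lemma incseq_level: "incseq level"
  unfolding level_def incseq_def by (auto intro!: ennreal_leI divide_left_mono)

lemma level_tendsto: "level \<longlonglongrightarrow> 1"
proof -
  have "(\<lambda>i. 1 - 1 / real (i + 2)) \<longlonglongrightarrow> 1 - 0"
    by (intro tendsto_diff tendsto_const LIMSEQ_ignore_initial_segment[OF lim_1_over_n])
  then show ?thesis
    using tendsto_ennrealI unfolding level_def by fastforce
qed

text \<open>The limit of the normalized functions, to which the identities for \<open>l < 1\<close>
  pass by monotone convergence. It is identified with the Neumann series of the ladder kernel in
  \<open>renewal_eq_suminf\<close>, and with \<open>V\<close> in \<open>theorem2\<close>.\<close>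

definition renewal :: "'a \<Rightarrow> ennreal" where
  "renewal x = (SUP i. normalized (level i) x)"

text \<open>A quotient of two increasing functions of \<open>l\<close> need not be monotone; the
  Neumann series is, because the entries of \<open>ladder_op l\<close> grow with
  \<open>l\<close>.\<close>

lemma incseq_normalized: "x \<in> E \<Longrightarrow> incseq (\<lambda>i. normalized (level i) x)"
  unfolding incseq_def
  by (simp add: normalized_eq_suminf level_less_1)
    (intro allI impI suminf_le summableI ladder_op_funpow_mono incseqD[OF incseq_level])

text \<open>After expansion, every power of \<open>level i\<close> multiplies an increasing
  sequence, so termwise suprema lose the discount. The exponent \<open>k\<close> is 1 for the shift
  identity and 0 for the convergence of \<open>g\<close>.\<close>

lemma resolvent_SUP:
  assumes "\<And>y. y \<in> E \<Longrightarrow> incseq (\<lambda>i. \<phi> i y)" "x \<in> E"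
  shows "(SUP i. level i ^ k * resolvent (level i) (\<phi> i) x) = resolvent 1 (\<lambda>y. SUP i. \<phi> i y) x"
proof -
  have inc: "incseq (\<lambda>i. (P ^^ n) (\<phi> i) x)" for n
    using assms unfolding incseq_def by (auto intro!: funpow_kernel_mono)
  have "(SUP i. level i ^ k * resolvent (level i) (\<phi> i) x)
      = (SUP i. \<Sum>n. level i ^ (k + n) * (P ^^ n) (\<phi> i) x)"
    by (simp add: resolvent_def power_add mult.assoc ennreal_suminf_cmult)
  also have "\<dots> = (\<Sum>n. SUP i. level i ^ (k + n) * (P ^^ n) (\<phi> i) x)"
    using inc incseq_level
    by (intro ennreal_suminf_SUP_eq[symmetric])
      (auto simp: incseq_def intro!: mult_mono power_mono_ennreal)
  also have "\<dots> = (\<Sum>n. (P ^^ n) (\<lambda>y. SUP i. \<phi> i y) x)"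
    by (simp add: SUP_powers_mult_eq[OF incseq_level level_tendsto inc] funpow_kernel_SUP assms)
  finally show ?thesis by (simp add: resolvent_def)
qed

lemma renewal_right_shift:
  assumes x: "x \<in> E" and u: "u \<in> E"
  shows "renewal (x \<otimes> u) = renewal x + resolvent 1 (A u renewal) x"
proof -
  have inc: "incseq (\<lambda>i. A u (normalized (level i)) y)" for y
    using incseq_normalized unfolding incseq_def by (auto intro!: kernel_op_mono)
  have "renewal (x \<otimes> u)
      = (SUP i. normalized (level i) x + level i ^ 1 * resolvent (level i) (A u (normalized (level i))) x)"
    by (simp add: renewal_def normalized_right_shift level_less_1 x u)
  also have "\<dots> = renewal x + (SUP i. level i ^ 1 * resolvent (level i) (A u (normalized (level i))) x)"
    unfolding renewal_def
  proof (rule ennreal_SUP_add[OF incseq_normalized[OF x]])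
    show "incseq (\<lambda>i. level i ^ 1 * resolvent (level i) (A u (normalized (level i))) x)"
      unfolding incseq_def power_one_right
      by (intro allI impI mult_mono resolvent_mono incseqD[OF incseq_level] incseqD[OF inc] x) auto
  qed
  also have "\<dots> = renewal x + resolvent 1 (\<lambda>y. SUP i. A u (normalized (level i)) y) x"
    by (simp only: resolvent_SUP[OF inc x])
  also have "(\<lambda>y. SUP i. A u (normalized (level i)) y) = A u renewal"
    unfolding renewal_def using kernel_op_SUP[OF incseq_normalized] by (auto simp: fun_eq_iff)
  finally show ?thesis .
qed

lemma renewal_one: "renewal \<one> = 1"
  by (simp add: renewal_def normalized_one level_less_1)

lemma renewal_fixpoint: "u \<in> E \<Longrightarrow> renewal u = 1 + ladder_op 1 renewal u"
  using renewal_right_shift[of \<one> u] by (simp add: renewal_one ladder_op_eq)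

lemma suminf_ladder_le:
  assumes "\<And>x. x \<in> E \<Longrightarrow> 1 + ladder_op 1 f x \<le> f x" "x \<in> E"
  shows "(\<Sum>n. (ladder_op 1 ^^ n) (\<lambda>_. 1) x) \<le> f x"
  using assms unfolding ladder_op_def by (intro supersolution_ge_suminf) auto

text \<open>Each normalized function has a Neumann series below the one for \<open>l = 1\<close>;
  conversely the limit solves the equation at \<open>l = 1\<close>, whose minimal solution is the
  Neumann series.\<close>

lemma renewal_eq_suminf:
  assumes "x \<in> E"
  shows "renewal x = (\<Sum>n. (ladder_op 1 ^^ n) (\<lambda>_. 1) x)"
proof (rule antisym)
  show "renewal x \<le> (\<Sum>n. (ladder_op 1 ^^ n) (\<lambda>_. 1) x)"
    unfolding renewal_def
    by (auto simp: normalized_eq_suminf level_less_1 assms less_imp_le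
        intro!: SUP_least suminf_le ladder_op_funpow_mono)
  show "(\<Sum>n. (ladder_op 1 ^^ n) (\<lambda>_. 1) x) \<le> renewal x"
    by (intro suminf_ladder_le assms) (simp flip: renewal_fixpoint)
qed

text \<open>The bound of \<open>normalized_le\<close> is the same for all levels; its constant comes
  from irreducibility.\<close>

lemma renewal_finite:
  assumes "x \<in> E"
  shows "renewal x < \<infinity>"
proof -
  obtain c where c: "0 < c" "c \<le> 1" "\<And>n. c * survival n x \<le> survival n \<one>"
    using survival_harnack[OF one_closed assms] by blast
  have "renewal x \<le> inverse c"
    unfolding renewal_def by (intro SUP_least normalized_le[OF assms level_less_1 c])
  also have "\<dots> < \<infinity>"
    using c by (auto simp: less_top[symmetric])
  finally show ?thesis .
qed

section \<open>The two cases for the mean absorption time\<close>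

lemma incseq_g: "x \<in> E \<Longrightarrow> incseq (\<lambda>i. g (level i) x)"
  unfolding incseq_def by (auto intro!: resolvent_mono incseqD[OF incseq_level])

lemma g_tendsto:
  assumes "x \<in> E"
  shows "(\<lambda>i. g (level i) x) \<longlonglongrightarrow> g 1 x"
proof -
  have "(SUP i. g (level i) x) = g 1 x"
    using resolvent_SUP[of "\<lambda>_ _. 1" x 0] assms by simp
  then show ?thesis using LIMSEQ_SUP[OF incseq_g[OF assms]] by simp
qed

lemma normalized_tendsto: "x \<in> E \<Longrightarrow> (\<lambda>i. normalized (level i) x) \<longlonglongrightarrow> renewal x"
  unfolding renewal_def by (intro LIMSEQ_SUP incseq_normalized)

text \<open>Dividing the equation \<open>g_eq\<close> by \<open>g l \<one>\<close> leaves the source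
  \<open>1 / g l \<one>\<close>, which tends to 0 because the mean absorption time is
  infinite.\<close>

lemma renewal_harmonic:
  assumes "g 1 \<one> = \<infinity>" "x \<in> E"
  shows "P renewal x = renewal x"
proof (rule LIMSEQ_unique)
  show "(\<lambda>i. normalized (level i) x) \<longlonglongrightarrow> renewal x"
    by (rule normalized_tendsto) fact
  have eq: "normalized (level i) x
      = inverse (g (level i) \<one>) + level i * P (normalized (level i)) x" for i
    unfolding normalized_eq kernel_op_cmult
    by (subst g_eq[OF \<open>x \<in> E\<close>]) (simp add: distrib_left mult.left_commute)
  have "continuous_on UNIV (\<lambda>x::ennreal. inverse x)"
    by (intro continuous_intros)
  then have "(\<lambda>i. inverse (g (level i) \<one>)) \<longlonglongrightarrow> inverse (g 1 \<one>)"
    using g_tendsto[OF one_closed] by (rule continuous_on_tendsto_compose) auto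
  then have 1: "(\<lambda>i. inverse (g (level i) \<one>)) \<longlonglongrightarrow> 0"
    using assms(1) by simp
  have inc: "incseq (\<lambda>i. P (normalized (level i)) x)"
    using incseq_normalized unfolding incseq_def by (auto intro!: kernel_op_mono)
  have "P renewal x = (SUP i. P (normalized (level i)) x)"
    unfolding renewal_def by (intro kernel_op_SUP incseq_normalized)
  then have "(\<lambda>i. P (normalized (level i)) x) \<longlonglongrightarrow> P renewal x"
    using LIMSEQ_SUP[OF inc] by simp
  then have "(\<lambda>i. level i * P (normalized (level i)) x) \<longlonglongrightarrow> 1 * P renewal x"
    by (intro tendsto_mult_ennreal level_tendsto) auto
  from tendsto_add[OF 1 this]
  show "(\<lambda>i. normalized (level i) x) \<longlonglongrightarrow> P renewal x"
    by (simp add: eq)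
qed

lemma renewal_eq_ratio:
  assumes "g 1 \<one> < \<infinity>" "x \<in> E"
  shows "renewal x = g 1 x / g 1 \<one>"
proof (rule LIMSEQ_unique)
  show "(\<lambda>i. normalized (level i) x) \<longlonglongrightarrow> renewal x"
    by (rule normalized_tendsto) fact
  have "continuous_on UNIV (\<lambda>x::ennreal. inverse x)"
    by (intro continuous_intros)
  then have "(\<lambda>i. inverse (g (level i) \<one>)) \<longlonglongrightarrow> inverse (g 1 \<one>)"
    using g_tendsto[OF one_closed] by (rule continuous_on_tendsto_compose) auto
  \<comment> \<open>Both \<open>g 1 x\<close> and \<open>inverse (g 1 \<one>)\<close> are nonzero,
    which excludes a product of 0 and \<infinity> in the limit.\<close>
  then have "(\<lambda>i. g (level i) x * inverse (g (level i) \<one>)) \<longlonglongrightarrow> g 1 x * inverse (g 1 \<one>)"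
    using assms(1) g_ge_1[OF assms(2), of 1] g_ge_1[OF one_closed, of 1]
    by (intro tendsto_mult_ennreal g_tendsto assms(2)) auto
  then show "(\<lambda>i. normalized (level i) x) \<longlonglongrightarrow> g 1 x / g 1 \<one>"
    by (simp add: normalized_def divide_ennreal_def)
qed

section \<open>Ratios of survival probabilities\<close>

definition survival_ratio :: "nat \<Rightarrow> 'a \<Rightarrow> ennreal" where
  "survival_ratio n x = survival n x / survival n \<one>"

lemma survival_ratio_eq: "survival_ratio n = (\<lambda>x. inverse (survival n \<one>) * survival n x)"
  by (simp add: survival_ratio_def divide_ennreal_def mult.commute fun_eq_iff)

lemma survival_ratio_one: "survival_ratio n \<one> = 1"
  using survival_pos[OF one_closed, of n] le_less_trans[OF survival_le_1[OF one_closed, of n], of \<infinity>]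
  by (auto simp: survival_ratio_def intro!: ennreal_divide_self)

lemma survival_right_shift_ge:
  assumes "x \<in> E" "u \<in> E" "m \<le> n"
  shows "survival m x + (\<Sum>k<m. (P ^^ k) (A u (survival n)) x) \<le> survival m (x \<otimes> u)"
  using assms(1,3)
proof (induction m arbitrary: x)
  case (Suc m)
  have "survival (Suc m) x + (\<Sum>k<Suc m. (P ^^ k) (A u (survival n)) x)
      = P (\<lambda>y. survival m y + (\<Sum>k<m. (P ^^ k) (A u (survival n)) y)) x + A u (survival n) x"
    by (simp add: kernel_op_add kernel_op_sum sum.lessThan_Suc_shift survival_Suc ac_simps
        del: sum.lessThan_Suc)
  also have "\<dots> \<le> P (\<lambda>y. survival m (y \<otimes> u)) x + A u (survival m) x"
    using Suc by (intro add_mono kernel_op_mono survival_antimono) auto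
  also have "\<dots> = survival (Suc m) (x \<otimes> u)"
    using Suc.prems assms(2) by (simp add: P_right_shift survival_Suc)
  finally show ?case .
qed simp

text \<open>Tail infima increase with \<open>N\<close>, which reduces Fatou's lemma to monotone
  convergence.\<close>

definition ratio_inf :: "nat \<Rightarrow> 'a \<Rightarrow> ennreal" where
  "ratio_inf N x = (INF n\<in>{N..}. survival_ratio n x)"

lemma incseq_ratio_inf: "incseq (\<lambda>N. ratio_inf N x)"
  unfolding incseq_def ratio_inf_def by (auto intro!: INF_superset_mono)

lemma ratio_inf_le: "N \<le> n \<Longrightarrow> ratio_inf N x \<le> survival_ratio n x"
  unfolding ratio_inf_def by (intro INF_lower) auto

lemma liminf_survival_ratio: "liminf (\<lambda>n. survival_ratio n x) = (SUP N. ratio_inf N x)"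
  by (simp add: liminf_SUP_INF ratio_inf_def)

text \<open>For \<open>n \<ge> N\<close> the truncated sum grows when \<open>ratio_inf N\<close> is
  replaced by \<open>survival_ratio n\<close> and when its length is raised to \<open>n\<close>.
  Then \<open>survival_right_shift_ge\<close> with \<open>m = n\<close>, divided by
  \<open>survival n \<one>\<close>, bounds it.\<close>

lemma ratio_inf_fixpoint_ge:
  assumes u: "u \<in> E"
  shows "1 + (\<Sum>k<N. (P ^^ k) (A u (ratio_inf N)) \<one>) \<le> ratio_inf N u"
  unfolding ratio_inf_def[of N u]
proof (rule INF_greatest)
  fix n assume "n \<in> {N..}"
  then have n: "N \<le> n" by simp
  have "(\<Sum>k<N. (P ^^ k) (A u (ratio_inf N)) \<one>) \<le> (\<Sum>k<N. (P ^^ k) (A u (survival_ratio n)) \<one>)"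
    by (intro sum_mono funpow_kernel_mono kernel_op_mono ratio_inf_le n one_closed)
  also have "\<dots> \<le> (\<Sum>k<n. (P ^^ k) (A u (survival_ratio n)) \<one>)"
    using n by (intro sum_mono2) auto
  also have "\<dots> = inverse (survival n \<one>) * (\<Sum>k<n. (P ^^ k) (A u (survival n)) \<one>)"
  proof -
    have "A u (survival_ratio n) = (\<lambda>y. inverse (survival n \<one>) * A u (survival n) y)"
      by (simp add: survival_ratio_eq kernel_op_cmult fun_eq_iff)
    then show ?thesis by (simp add: funpow_kernel_cmult sum_distrib_left)
  qed
  finally have "1 + (\<Sum>k<N. (P ^^ k) (A u (ratio_inf N)) \<one>)
      \<le> survival_ratio n \<one> + inverse (survival n \<one>) * (\<Sum>k<n. (P ^^ k) (A u (survival n)) \<one>)"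
    by (simp add: survival_ratio_one)
  also have "\<dots> = inverse (survival n \<one>) * (survival n \<one> + (\<Sum>k<n. (P ^^ k) (A u (survival n)) \<one>))"
    by (simp add: survival_ratio_eq distrib_left)
  also have "\<dots> \<le> inverse (survival n \<one>) * survival n (\<one> \<otimes> u)"
    by (intro mult_left_mono survival_right_shift_ge u one_closed) auto
  also have "\<dots> = survival_ratio n u"
    using u by (simp add: survival_ratio_eq)
  finally show "1 + (\<Sum>k<N. (P ^^ k) (A u (ratio_inf N)) \<one>) \<le> survival_ratio n u" .
qed

lemma renewal_le_liminf:
  assumes "x \<in> E"
  shows "renewal x \<le> liminf (\<lambda>n. survival_ratio n x)"
proof -
  let ?r = "\<lambda>x. SUP N. ratio_inf N x"
  have "1 + ladder_op 1 ?r u \<le> ?r u" if u: "u \<in> E" for u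
  proof -
    have inc: "incseq (\<lambda>N. A u (ratio_inf N) y)" for y
      using incseq_ratio_inf unfolding incseq_def by (auto intro!: kernel_op_mono)
    have incP: "incseq (\<lambda>N. (P ^^ k) (A u (ratio_inf N)) \<one>)" for k
      using inc unfolding incseq_def by (auto intro!: funpow_kernel_mono)
    have A_SUP: "A u ?r = (\<lambda>y. SUP N. A u (ratio_inf N) y)"
      by (simp add: fun_eq_iff kernel_op_SUP incseq_ratio_inf)
    have lim: "(\<lambda>N. (P ^^ k) (A u (ratio_inf N)) \<one>) \<longlonglongrightarrow> (P ^^ k) (A u ?r) \<one>" for k
      unfolding A_SUP funpow_kernel_SUP[OF inc one_closed] by (rule LIMSEQ_SUP[OF incP])
    \<comment> \<open>\<open>N\<close> also counts terms, so the number of terms is first fixed at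
      \<open>K\<close> while N \<rightarrow> \<infinity>; then K \<rightarrow> \<infinity>.\<close>
    have "1 + (\<Sum>k<K. (P ^^ k) (A u ?r) \<one>) \<le> ?r u" for K
    proof (rule LIMSEQ_le_const2)
      show "(\<lambda>N. 1 + (\<Sum>k<K. (P ^^ k) (A u (ratio_inf N)) \<one>)) \<longlonglongrightarrow> 1 + (\<Sum>k<K. (P ^^ k) (A u ?r) \<one>)"
        by (intro tendsto_add tendsto_const tendsto_sum lim)
      have "1 + (\<Sum>k<K. (P ^^ k) (A u (ratio_inf N)) \<one>) \<le> ?r u" if "K \<le> N" for N
      proof -
        have "1 + (\<Sum>k<K. (P ^^ k) (A u (ratio_inf N)) \<one>) \<le> 1 + (\<Sum>k<N. (P ^^ k) (A u (ratio_inf N)) \<one>)"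
          using that by (intro add_left_mono sum_mono2) auto
        also have "\<dots> \<le> ratio_inf N u" by (rule ratio_inf_fixpoint_ge[OF u])
        also have "\<dots> \<le> ?r u" by (rule SUP_upper) simp
        finally show ?thesis .
      qed
      then show "\<exists>M. \<forall>N\<ge>M. 1 + (\<Sum>k<K. (P ^^ k) (A u (ratio_inf N)) \<one>) \<le> ?r u" by blast
    qed
    moreover have "(\<lambda>K. 1 + (\<Sum>k<K. (P ^^ k) (A u ?r) \<one>)) \<longlonglongrightarrow> 1 + (\<Sum>k. (P ^^ k) (A u ?r) \<one>)"
      by (intro tendsto_add tendsto_const summable_LIMSEQ summableI)
    ultimately have "1 + (\<Sum>k. (P ^^ k) (A u ?r) \<one>) \<le> ?r u"
      by (intro LIMSEQ_le_const2) auto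
    then show ?thesis by (simp add: ladder_op_eq resolvent_def)
  qed
  then show ?thesis
    unfolding renewal_eq_suminf[OF assms] liminf_survival_ratio
    by (intro suminf_ladder_le assms)
qed

text \<open>Isolate in \<open>P ^^ m\<close>, started at the identity, the positive weight
  \<open>c\<close> on \<open>x\<close>. The total over all states is at most 1 for
  \<open>survival_ratio n\<close> and equals 1 for \<open>renewal\<close>, while away from
  \<open>x\<close> the ratios are asymptotically at least \<open>renewal\<close>; hence no excess at
  \<open>x\<close> is possible.\<close>

lemma limsup_le_renewal:
  assumes harm: "\<And>x. x \<in> E \<Longrightarrow> P renewal x = renewal x" and x: "x \<in> E"
  shows "limsup (\<lambda>n. survival_ratio n x) \<le> renewal x"
proof -
  obtain m where m: "0 < (P ^^ m) (indicator {x}) \<one>"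
    using irreducible[OF one_closed x] by (auto simp: trans_op_def)
  define c where "c = (P ^^ m) (indicator {x}) \<one>"
  define off :: "('a \<Rightarrow> ennreal) \<Rightarrow> 'a \<Rightarrow> ennreal" where
    "off \<phi> y = (if y = x then 0 else \<phi> y)" for \<phi> y
  have "c \<le> survival m \<one>"
    unfolding survival_def c_def by (intro funpow_kernel_mono) (auto simp: indicator_def)
  also have "\<dots> \<le> 1" by (rule survival_le_1) simp
  finally have "c < \<infinity>" by (rule le_less_trans) simp
  with m have c: "c \<noteq> 0" "c \<noteq> \<infinity>" by (auto simp: c_def)
  have split: "(P ^^ m) \<phi> \<one> = c * \<phi> x + (P ^^ m) (off \<phi>) \<one>" for \<phi>
  proof -
    have "(P ^^ m) \<phi> \<one> = (P ^^ m) (\<lambda>y. \<phi> x * indicator {x} y + off \<phi> y) \<one>"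
      by (intro funpow_kernel_cong) (auto simp: off_def)
    then show ?thesis
      by (simp add: funpow_kernel_add funpow_kernel_cmult c_def mult.commute)
  qed
  have "(P ^^ m) renewal y = renewal y" if "y \<in> E" for y
    using that
  proof (induction m arbitrary: y)
    case (Suc m)
    have "P ((P ^^ m) renewal) y = P renewal y"
      by (intro kernel_op_cong Suc.IH)
    then show ?case using harm Suc.prems by simp
  qed simp
  then have renewal_split: "c * renewal x + (P ^^ m) (off renewal) \<one> = 1"
    using split[of renewal] by (simp add: renewal_one)
  \<comment> \<open>Finiteness permits the final cancellation of this summand in
    \<open>ennreal\<close>.\<close>
  then have off_finite: "(P ^^ m) (off renewal) \<one> \<noteq> \<infinity>"
    by (metis ennreal_add_eq_top ennreal_one_neq_top infinity_ennreal_def)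
  have ratio: "c * survival_ratio n x + (P ^^ m) (off (ratio_inf N)) \<one> \<le> 1" if "N \<le> n" for n N
  proof -
    have "c * survival_ratio n x + (P ^^ m) (off (ratio_inf N)) \<one> \<le> (P ^^ m) (survival_ratio n) \<one>"
      unfolding split[of "survival_ratio n"] using ratio_inf_le[OF that]
      by (intro add_left_mono funpow_kernel_mono) (auto simp: off_def)
    also have "\<dots> = inverse (survival n \<one>) * survival (m + n) \<one>"
      by (simp add: survival_ratio_eq funpow_kernel_cmult survival_def funpow_add)
    also have "\<dots> \<le> inverse (survival n \<one>) * survival n \<one>"
      by (intro mult_left_mono survival_antimono) auto
    also have "\<dots> = 1"
      using survival_ratio_one[of n] by (simp add: survival_ratio_eq)
    finally show ?thesis .
  qed
  let ?L = "limsup (\<lambda>n. survival_ratio n x)"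
  \<comment> \<open>The limit superior is below the supremum over \<open>n \<ge> N\<close>, and on
    that range \<open>ratio\<close> holds with \<open>ratio_inf N\<close> fixed, so the supremum can
    be taken in the first summand alone.\<close>
  have "c * ?L + (P ^^ m) (off (ratio_inf N)) \<one> \<le> 1" for N
  proof -
    have "c * ?L + (P ^^ m) (off (ratio_inf N)) \<one>
        \<le> c * (SUP n\<in>{N..}. survival_ratio n x) + (P ^^ m) (off (ratio_inf N)) \<one>"
      unfolding limsup_INF_SUP by (intro add_right_mono mult_left_mono INF_lower) auto
    also have "\<dots> = (SUP n\<in>{N..}. c * survival_ratio n x + (P ^^ m) (off (ratio_inf N)) \<one>)"
      by (subst ennreal_SUP_add_left) (auto simp: SUP_mult_left_ennreal)
    also have "\<dots> \<le> 1"
      using ratio by (intro SUP_least) auto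
    finally show ?thesis .
  qed
  then have "c * ?L + (SUP N. (P ^^ m) (off (ratio_inf N)) \<one>) \<le> 1"
    by (subst ennreal_SUP_add_right) (auto intro!: SUP_least)
  moreover have "(P ^^ m) (off renewal) \<one> \<le> (SUP N. (P ^^ m) (off (ratio_inf N)) \<one>)"
  proof -
    have "(P ^^ m) (off renewal) \<one> \<le> (P ^^ m) (\<lambda>y. SUP N. off (ratio_inf N) y) \<one>"
      using renewal_le_liminf
      by (intro funpow_kernel_mono) (auto simp: off_def liminf_survival_ratio)
    also have "\<dots> = (SUP N. (P ^^ m) (off (ratio_inf N)) \<one>)"
      using incseq_ratio_inf by (intro funpow_kernel_SUP) (auto simp: off_def incseq_def)
    finally show ?thesis .
  qed
  ultimately have "c * ?L + (P ^^ m) (off renewal) \<one> \<le> c * renewal x + (P ^^ m) (off renewal) \<one>"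
    unfolding renewal_split by (meson add_left_mono order_trans)
  then have "c * ?L \<le> c * renewal x"
    using off_finite by (simp add: add.commute[of "c * _"] ennreal_add_left_cancel_le)
  then show ?thesis
    using c by (simp add: ennreal_mult_le_mult_iff)
qed

lemma survival_ratio_tendsto:
  assumes "g 1 \<one> = \<infinity>" "x \<in> E"
  shows "(\<lambda>n. survival_ratio n x) \<longlonglongrightarrow> renewal x"
proof (rule tendsto_iff_Liminf_eq_Limsup[THEN iffD2])
  have "limsup (\<lambda>n. survival_ratio n x) \<le> renewal x"
    using renewal_harmonic[OF assms(1)] by (intro limsup_le_renewal assms(2))
  moreover note renewal_le_liminf[OF assms(2)]
  moreover have "liminf (\<lambda>n. survival_ratio n x) \<le> limsup (\<lambda>n. survival_ratio n x)"
    by (intro Liminf_le_Limsup) simp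
  ultimately show "liminf (\<lambda>n. survival_ratio n x) = renewal x
      \<and> limsup (\<lambda>n. survival_ratio n x) = renewal x"
    by (auto intro!: antisym intro: order_trans)
qed simp

end

section \<open>Absorbed Markov chains\<close>

lemma absorption_time_gt_iff:
  "of_nat n < absorption_time k X \<omega> \<longleftrightarrow> (\<forall>t\<le>n. k \<le> t \<longrightarrow> X t \<omega> \<noteq> None)"
proof
  assume less: "of_nat n < absorption_time k X \<omega>"
  show "\<forall>t\<le>n. k \<le> t \<longrightarrow> X t \<omega> \<noteq> None"
  proof (intro allI impI notI)
    fix t assume t: "t \<le> n" "k \<le> t" "X t \<omega> = None"
    then have "absorption_time k X \<omega> \<le> of_nat t"
      unfolding absorption_time_def by (intro INF_lower) auto
    also have "\<dots> \<le> of_nat n" using t by (simp add: of_nat_mono)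
    finally show False using less by simp
  qed
next
  assume alive: "\<forall>t\<le>n. k \<le> t \<longrightarrow> X t \<omega> \<noteq> None"
  \<comment> \<open>An infimum yields only weak lower bounds, so strictness comes from passing
    through \<open>Suc n\<close>.\<close>
  have "(of_nat n :: ennreal) < of_nat (Suc n)"
    by (simp add: ennreal_of_nat_eq_real_of_nat ennreal_less_iff del: of_nat_Suc)
  also have "\<dots> \<le> absorption_time k X \<omega>"
    unfolding absorption_time_def
    using alive by (intro INF_greatest of_nat_mono) (auto simp: not_less_eq_eq[symmetric])
  finally show "of_nat n < absorption_time k X \<omega>" .
qed

text \<open>Layer-cake formula; integrated, it turns the mean absorption time into the sum of
  survival probabilities.\<close>

lemma absorption_time_eq_suminf:
  "absorption_time k X \<omega> = (\<Sum>n. if of_nat n < absorption_time k X \<omega> then 1 else 0)"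
proof (cases "\<exists>t. k \<le> t \<and> X t \<omega> = None")
  case True
  define T where "T = (LEAST t. k \<le> t \<and> X t \<omega> = None)"
  have T: "k \<le> T" "X T \<omega> = None" and least: "\<And>t. k \<le> t \<Longrightarrow> X t \<omega> = None \<Longrightarrow> T \<le> t"
    using LeastI_ex[OF True] by (auto simp: T_def intro: Least_le)
  have "absorption_time k X \<omega> = of_nat T"
    unfolding absorption_time_def
    using T least by (intro antisym INF_lower INF_greatest of_nat_mono) auto
  moreover have "of_nat n < absorption_time k X \<omega> \<longleftrightarrow> n < T" for n
    unfolding absorption_time_gt_iff using T least by (force simp: not_less[symmetric])
  moreover have "(\<Sum>n. if n < T then 1 else 0 :: ennreal) = of_nat T"
    by (subst suminf_finite[of "{..<T}"]) auto
  ultimately show ?thesis by simp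
next
  case False
  then have "of_nat n < absorption_time k X \<omega>" for n
    by (auto simp: absorption_time_gt_iff)
  moreover have "absorption_time k X \<omega> = \<infinity>"
    using False unfolding absorption_time_def by auto
  moreover have "(\<Sum>n::nat. 1 :: ennreal) = \<infinity>"
    by (subst nn_integral_count_space_nat[symmetric]) simp
  ultimately show ?thesis by simp
qed

section \<open>Path laws in terms of powers of the kernel\<close>

text \<open>The matrix is left arbitrary since the locale is used twice: for the chain with
  \<open>p\<close>, and for the ladder process with \<open>ladder_kernel\<close>.\<close>

locale absorbed_chain = countable_space E
  for E :: "'a set" +
  fixes k :: "'a \<Rightarrow> 'a \<Rightarrow> real"
    and N :: "'a \<Rightarrow> 'w measure" and Y :: "nat \<Rightarrow> 'w \<Rightarrow> 'a option"
  assumes chain: "markov_chain E k N Y"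
begin

abbreviation K :: "('a \<Rightarrow> ennreal) \<Rightarrow> 'a \<Rightarrow> ennreal" where
  "K \<equiv> kernel_op E (\<lambda>x y. ennreal (k x y))"

lemma prob_space_N: "x \<in> E \<Longrightarrow> prob_space (N x)"
  using chain by (simp add: markov_chain_def)

lemma measurable_Y: "x \<in> E \<Longrightarrow> Y t \<in> N x \<rightarrow>\<^sub>M count_space UNIV"
  using chain measurable_compose[of "Y t" "N x" "count_space (completed E)" "\<lambda>y. y" "count_space UNIV"]
  by (simp add: markov_chain_def)

lemma Y_in_completed: "x \<in> E \<Longrightarrow> \<omega> \<in> space (N x) \<Longrightarrow> Y t \<omega> \<in> completed E"
  using chain measurable_space[of "Y t" "N x" "count_space (completed E)"]
  by (simp add: markov_chain_def)

lemma Y_0: "x \<in> E \<Longrightarrow> AE \<omega> in N x. Y 0 \<omega> = Some x"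
  using chain by (simp add: markov_chain_def)

lemma emeasure_split_at:
  assumes x: "x \<in> E" and Q: "Measurable.pred (N x) Q"
  shows "emeasure (N x) {\<omega> \<in> space (N x). Q \<omega>}
    = (\<integral>\<^sup>+v. emeasure (N x) {\<omega> \<in> space (N x). Y j \<omega> = v \<and> Q \<omega>} \<partial>count_space (completed E))"
proof -
  note [measurable] = Q measurable_Y[OF x]
  have "{\<omega> \<in> space (N x). Q \<omega>} = (\<Union>v\<in>completed E. {\<omega> \<in> space (N x). Y j \<omega> = v \<and> Q \<omega>})"
    using Y_in_completed[OF x] by blast
  then show ?thesis
    by (simp only:) (subst emeasure_UN_countable,
        auto simp: disjoint_family_on_def countable_E)
qed

text \<open>Summing out the coordinates before \<open>j\<close> one at a time turns the path-wise Markov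
  property into the one-step property at time \<open>n\<close>.\<close>

lemma markov_from:
  assumes x: "x \<in> E" and z: "z \<in> completed E" and "j \<le> n" and "\<And>i. s i \<in> completed E"
  shows "emeasure (N x) {\<omega> \<in> space (N x). (\<forall>i\<in>{j..n}. Y i \<omega> = s i) \<and> Y (Suc n) \<omega> = z}
    = emeasure (N x) {\<omega> \<in> space (N x). \<forall>i\<in>{j..n}. Y i \<omega> = s i} * ennreal (completed_kernel E k (s n) z)"
  using assms(3,4)
proof (induction j arbitrary: s)
  case 0
  interpret prob_space "N x" by (rule prob_space_N[OF x])
  have "\<forall>n s. \<forall>z\<in>completed E. (\<forall>i\<le>n. s i \<in> completed E) \<longrightarrow>
      prob {\<omega> \<in> space (N x). (\<forall>i\<le>n. Y i \<omega> = s i) \<and> Y (Suc n) \<omega> = z}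
      = prob {\<omega> \<in> space (N x). \<forall>i\<le>n. Y i \<omega> = s i} * completed_kernel E k (s n) z"
    using chain x unfolding markov_chain_def by blast
  then have "prob {\<omega> \<in> space (N x). (\<forall>i\<le>n. Y i \<omega> = s i) \<and> Y (Suc n) \<omega> = z}
      = prob {\<omega> \<in> space (N x). \<forall>i\<le>n. Y i \<omega> = s i} * completed_kernel E k (s n) z"
    using z 0 by blast
  then show ?case
    by (simp only: emeasure_eq_measure ennreal_mult' measure_nonneg atLeast0AtMost Ball_def atMost_iff)
next
  case (Suc j)
  note [measurable] = measurable_Y[OF x]
  have upd: "(Y j \<omega> = v \<and> (\<forall>i\<in>{Suc j..n}. Y i \<omega> = s i) \<and> R)
      \<longleftrightarrow> ((\<forall>i\<in>{j..n}. Y i \<omega> = (s(j := v)) i) \<and> R)" for v \<omega> R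
    using Suc.prems(1) by (auto simp: Suc_le_eq le_less)
  have upd': "(Y j \<omega> = v \<and> (\<forall>i\<in>{Suc j..n}. Y i \<omega> = s i))
      \<longleftrightarrow> (\<forall>i\<in>{j..n}. Y i \<omega> = (s(j := v)) i)" for v \<omega>
    using upd[of \<omega> v True] by simp
  have "emeasure (N x) {\<omega> \<in> space (N x). (\<forall>i\<in>{Suc j..n}. Y i \<omega> = s i) \<and> Y (Suc n) \<omega> = z}
      = (\<integral>\<^sup>+v. emeasure (N x) {\<omega> \<in> space (N x). (\<forall>i\<in>{j..n}. Y i \<omega> = (s(j := v)) i) \<and> Y (Suc n) \<omega> = z}
          \<partial>count_space (completed E))"
    by (subst emeasure_split_at[OF x, of _ j]) (simp_all only: upd, measurable)
  also have "\<dots> = (\<integral>\<^sup>+v. emeasure (N x) {\<omega> \<in> space (N x). \<forall>i\<in>{j..n}. Y i \<omega> = (s(j := v)) i}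
          * ennreal (completed_kernel E k (s n) z) \<partial>count_space (completed E))"
    using Suc.prems by (intro nn_integral_cong) (subst Suc.IH, auto)
  also have "\<dots> = emeasure (N x) {\<omega> \<in> space (N x). \<forall>i\<in>{Suc j..n}. Y i \<omega> = s i}
      * ennreal (completed_kernel E k (s n) z)"
    by (subst emeasure_split_at[OF x, of _ j]) (simp_all only: upd' nn_integral_multc borel_measurable_count_space, measurable)
  finally show ?case .
qed

lemma markov_step:
  assumes "x \<in> E" "z \<in> completed E" "w \<in> completed E"
  shows "emeasure (N x) {\<omega> \<in> space (N x). Y n \<omega> = w \<and> Y (Suc n) \<omega> = z}
    = emeasure (N x) {\<omega> \<in> space (N x). Y n \<omega> = w} * ennreal (completed_kernel E k w z)"
  using markov_from[OF assms(1,2) order_refl, of "\<lambda>_. w" n] assms(3) by simp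

lemma nn_integral_completed:
  assumes "f None = 0"
  shows "(\<integral>\<^sup>+v. f v \<partial>count_space (completed E)) = (\<integral>\<^sup>+y. f (Some y) \<partial>count_space E)"
proof -
  have "(\<integral>\<^sup>+v. f v \<partial>count_space (completed E)) = (\<integral>\<^sup>+v. f v \<partial>count_space (Some ` E))"
    using assms by (intro nn_integral_count_space_eq) auto
  also have "\<dots> = (\<integral>\<^sup>+y. f (Some y) \<partial>count_space E)"
    by (intro nn_integral_bij_count_space[symmetric]) (auto simp: bij_betw_def)
  finally show ?thesis .
qed

text \<open>Conditioning on the state at time \<open>n\<close> adds the last step, which
  \<open>funpow_swap1\<close> reconciles with the recursion of the powers. The cemetery term drops
  out, since \<open>completed_kernel\<close> never leads from \<open>None\<close> to a state of
  \<open>E\<close>.\<close>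

lemma emeasure_Y_eq:
  assumes x: "x \<in> E" and "y \<in> E"
  shows "emeasure (N x) {\<omega> \<in> space (N x). Y n \<omega> = Some y} = (K ^^ n) (indicator {y}) x"
  using assms(2)
proof (induction n arbitrary: y)
  case 0
  interpret prob_space "N x" by (rule prob_space_N[OF x])
  note [measurable] = measurable_Y[OF x]
  have "emeasure (N x) {\<omega> \<in> space (N x). Y 0 \<omega> = Some y}
      = emeasure (N x) (if x = y then space (N x) else {})"
  proof (rule emeasure_eq_AE)
    show "AE \<omega> in N x. \<omega> \<in> {\<omega> \<in> space (N x). Y 0 \<omega> = Some y} \<longleftrightarrow> \<omega> \<in> (if x = y then space (N x) else {})"
      using Y_0[OF x] AE_space by eventually_elim auto
  qed auto
  then show ?case using emeasure_space_1 by (cases "x = y") auto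
next
  case (Suc n)
  note [measurable] = measurable_Y[OF x]
  have "emeasure (N x) {\<omega> \<in> space (N x). Y (Suc n) \<omega> = Some y}
      = (\<integral>\<^sup>+v. emeasure (N x) {\<omega> \<in> space (N x). Y n \<omega> = v \<and> Y (Suc n) \<omega> = Some y}
          \<partial>count_space (completed E))"
    by (rule emeasure_split_at[OF x]) measurable
  also have "\<dots> = (\<integral>\<^sup>+v. emeasure (N x) {\<omega> \<in> space (N x). Y n \<omega> = v}
      * ennreal (completed_kernel E k v (Some y)) \<partial>count_space (completed E))"
    using Suc.prems x by (intro nn_integral_cong markov_step) auto
  also have "\<dots> = (\<integral>\<^sup>+w. emeasure (N x) {\<omega> \<in> space (N x). Y n \<omega> = Some w} * ennreal (k w y) \<partial>count_space E)"
    by (subst nn_integral_completed) simp_all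
  also have "\<dots> = (\<integral>\<^sup>+w. (K ^^ n) (indicator {w}) x * K (indicator {y}) w \<partial>count_space E)"
    using Suc by (intro nn_integral_cong) (simp add: kernel_op_indicator)
  also have "\<dots> = (K ^^ n) (K (indicator {y})) x"
    by (subst funpow_kernel_repr[OF x]) (simp only: kernel_op_eq[of _ "K (indicator {y})"])
  finally show ?case by (simp add: funpow_swap1)
qed

lemma green_eq:
  "x \<in> E \<Longrightarrow> y \<in> E \<Longrightarrow> green N Y x y = (\<Sum>n. (K ^^ n) (indicator {y}) x)"
  by (simp add: green_def emeasure_Y_eq)

lemma emeasure_alive:
  assumes x: "x \<in> E"
  shows "emeasure (N x) {\<omega> \<in> space (N x). Y n \<omega> \<noteq> None} = (K ^^ n) (\<lambda>_. 1) x"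
proof -
  note [measurable] = measurable_Y[OF x]
  have "emeasure (N x) {\<omega> \<in> space (N x). Y n \<omega> \<noteq> None}
      = (\<integral>\<^sup>+v. emeasure (N x) {\<omega> \<in> space (N x). Y n \<omega> = v \<and> Y n \<omega> \<noteq> None} \<partial>count_space (completed E))"
    by (rule emeasure_split_at[OF x]) measurable
  also have "\<dots> = (\<integral>\<^sup>+y. emeasure (N x) {\<omega> \<in> space (N x). Y n \<omega> = Some y} \<partial>count_space E)"
  proof (subst nn_integral_completed)
    show "emeasure (N x) {\<omega> \<in> space (N x). Y n \<omega> = None \<and> Y n \<omega> \<noteq> None} = 0"
    proof -
      have empty: "{\<omega> \<in> space (N x). Y n \<omega> = None \<and> Y n \<omega> \<noteq> None} = {}" by blast
      show ?thesis unfolding empty by simp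
    qed
  qed (auto intro!: nn_integral_cong arg_cong[where f="emeasure (N x)"])
  also have "\<dots> = (\<integral>\<^sup>+y. (K ^^ n) (indicator {y}) x * 1 \<partial>count_space E)"
    using x by (intro nn_integral_cong) (simp add: emeasure_Y_eq)
  also have "\<dots> = (K ^^ n) (\<lambda>_. 1) x"
    by (subst (2) funpow_kernel_repr[OF x]) (simp only: kernel_op_eq[of _ "\<lambda>_. 1"])
  finally show ?thesis .
qed

text \<open>Each return from \<open>None\<close> to a given \<open>y\<close> at a given time is
  null, and there are only countably many such pairs; off their union, induction rules out every
  return.\<close>

lemma Y_absorbed:
  assumes x: "x \<in> E"
  shows "AE \<omega> in N x. \<forall>m n. m \<le> n \<longrightarrow> Y m \<omega> = None \<longrightarrow> Y n \<omega> = None"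
proof -
  note [measurable] = measurable_Y[OF x]
  have "AE \<omega> in N x. \<not> (Y n \<omega> = None \<and> Y (Suc n) \<omega> = Some y)" if "y \<in> E" for n y
    using markov_step[OF x, of "Some y" None n] that
    by (subst AE_iff_measurable[OF _ refl]) (simp_all, measurable)
  then have "AE \<omega> in N x. \<forall>n. \<forall>y\<in>E. \<not> (Y n \<omega> = None \<and> Y (Suc n) \<omega> = Some y)"
    by (intro AE_all_countable[THEN iffD2] allI AE_ball_countable[OF countable_E, THEN iffD2] ballI)
  then show ?thesis
  proof (rule AE_mp, intro AE_I2 impI allI)
    fix \<omega> m n
    assume \<omega>: "\<omega> \<in> space (N x)" and dead: "Y m \<omega> = None" and "m \<le> n"
      and no_return: "\<forall>n. \<forall>y\<in>E. \<not> (Y n \<omega> = None \<and> Y (Suc n) \<omega> = Some y)"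
    from \<open>m \<le> n\<close> show "Y n \<omega> = None"
    proof (induction rule: dec_induct)
      case (step i)
      then show ?case
        using Y_in_completed[OF x \<omega>, of "Suc i"] no_return by blast
    qed (fact dead)
  qed
qed

text \<open>By absorption, being alive at time \<open>n\<close> entails being alive before. The
  start is almost surely in \<open>E\<close>, so counting from time 0 (for the ladder process) or
  from time 1 (for \<tau>) gives the same law.\<close>

lemma emeasure_absorption_time_gt:
  assumes x: "x \<in> E" and "j \<le> 1"
  shows "emeasure (N x) {\<omega> \<in> space (N x). of_nat n < absorption_time j Y \<omega>} = (K ^^ n) (\<lambda>_. 1) x"
proof -
  note [measurable] = measurable_Y[OF x]
  have "AE \<omega> in N x. (\<forall>t\<le>n. j \<le> t \<longrightarrow> Y t \<omega> \<noteq> None) \<longleftrightarrow> Y n \<omega> \<noteq> None"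
    using Y_absorbed[OF x] Y_0[OF x]
  proof eventually_elim
    case (elim \<omega>)
    show ?case
    proof (cases "j \<le> n")
      \<comment> \<open>Here no time \<open>t\<close> satisfies the constraint, and the right-hand
        side holds because \<open>Y 0\<close> is almost surely \<open>Some x\<close>.\<close>
      case False
      with \<open>j \<le> 1\<close> have "n = 0" "j = 1" by auto
      with elim(2) show ?thesis by auto
    qed (use elim(1) in \<open>metis order_refl\<close>)
  qed
  then have "AE \<omega> in N x. \<omega> \<in> {\<omega> \<in> space (N x). \<forall>t\<le>n. j \<le> t \<longrightarrow> Y t \<omega> \<noteq> None}
      \<longleftrightarrow> \<omega> \<in> {\<omega> \<in> space (N x). Y n \<omega> \<noteq> None}"
    by eventually_elim (simp only: mem_Collect_eq)
  then show ?thesis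
    unfolding absorption_time_gt_iff emeasure_alive[OF x, symmetric]
    by (rule emeasure_eq_AE) measurable
qed

lemma survival_prob_eq: "x \<in> E \<Longrightarrow> survival_prob N Y n x = (K ^^ n) (\<lambda>_. 1) x"
  by (simp add: survival_prob_def emeasure_absorption_time_gt)

lemma mean_absorption_time_eq:
  assumes x: "x \<in> E" and j: "j \<le> 1"
  shows "mean_absorption_time j N Y x = (\<Sum>n. (K ^^ n) (\<lambda>_. 1) x)"
proof -
  note [measurable] = measurable_Y[OF x]
  have [measurable]: "Measurable.pred (N x) (\<lambda>\<omega>. of_nat n < absorption_time j Y \<omega>)" for n
    unfolding absorption_time_gt_iff by measurable
  have "mean_absorption_time j N Y x
      = (\<integral>\<^sup>+\<omega>. (\<Sum>n. indicator {\<omega> \<in> space (N x). of_nat n < absorption_time j Y \<omega>} \<omega>) \<partial>N x)"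
    unfolding mean_absorption_time_def
    by (intro nn_integral_cong, subst absorption_time_eq_suminf) (auto intro!: suminf_cong)
  also have "\<dots> = (\<Sum>n. emeasure (N x) {\<omega> \<in> space (N x). of_nat n < absorption_time j Y \<omega>})"
    by (subst nn_integral_suminf) auto
  finally show ?thesis
    by (simp only: emeasure_absorption_time_gt[OF x j])
qed

end


section \<open>Transfer to the chain and its ladder process\<close>

theorem theorem2:
  fixes \<G> :: "('a, 'b) monoid_scheme" (structure)
    and E :: "'a set"
    and p :: "'a \<Rightarrow> 'a \<Rightarrow> real"
    and M :: "'a \<Rightarrow> 'w measure" and X :: "nat \<Rightarrow> 'w \<Rightarrow> 'a option"
    and N :: "'a \<Rightarrow> 'v measure" and H :: "nat \<Rightarrow> 'v \<Rightarrow> 'a option"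
    and V :: "'a option \<Rightarrow> ennreal"
  assumes "group \<G>" and "submonoid E \<G>" and "countable E"
    and "substochastic E p"
    and "markov_chain E p M X"
    and "irreducible_chain E M X" and "transient_chain E M X"
    and "\<And>x y u. x \<in> E \<Longrightarrow> y \<in> E \<Longrightarrow> u \<in> E \<Longrightarrow> p (x \<otimes> u) (y \<otimes> u) \<ge> p x y"
    and "markov_chain E (ladder_kernel \<G> E p M X) N H"
  defines "V \<equiv> renewal_fn N H"
  shows
    "transient_chain E N H
     \<and> ((\<forall>z\<in>completed E. V z < \<infinity>) \<and> V (Some \<one>) = 1 \<and>
        (\<forall>x\<in>E. \<forall>u\<in>E. V (Some (x \<otimes> u)) =
           V (Some x) + green_op E M X (shift_op \<G> E p u (\<lambda>y. V (Some y))) x))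
     \<and> ((\<forall>x\<in>E. mean_absorption_time 1 M X x = \<infinity>) \<longrightarrow>
        harmonic_function E p (\<lambda>x. V (Some x)) \<and>
        (\<forall>x\<in>E. (\<lambda>n. survival_prob M X n x / survival_prob M X n \<one>) \<longlonglongrightarrow> V (Some x)))
     \<and> ((\<forall>x\<in>E. mean_absorption_time 1 M X x < \<infinity>) \<longrightarrow>
        potential_function E M X (\<lambda>x. V (Some x)) \<and>
        (\<forall>x\<in>E. V (Some x) = mean_absorption_time 1 M X x / mean_absorption_time 1 M X \<one> \<and>
           V (Some x) \<le> liminf (\<lambda>n. survival_prob M X n x / survival_prob M X n \<one>)))"
proof -
  interpret countable_space E
    by (rule countable_space.intro) fact
  interpret X: absorbed_chain E p M X
    by unfold_locales fact
  interpret H: absorbed_chain E "ladder_kernel \<G> E p M X" N H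
    by unfold_locales fact
  interpret right_monotone_kernel E \<G> p
  proof (intro right_monotone_kernel.intro countable_space.intro right_monotone_kernel_axioms.intro assms)
    fix x y assume "x \<in> E" "y \<in> E"
    then show "\<exists>n\<ge>1. 0 < (trans_op E p ^^ n) (indicator {y}) x"
      using assms(6) by (simp add: irreducible_chain_def X.emeasure_Y_eq trans_op_def)
  qed
  have green: "green_op E M X \<phi> x = resolvent 1 \<phi> x" if x: "x \<in> E" for x \<phi>
    unfolding resolvent_repr[OF x] green_op_def
    by (intro antisym kernel_op_kernel_mono) (simp_all add: resolvent_def X.green_eq x)
  \<comment> \<open>\<open>enn2real\<close> would turn an infinite entry into 0, so finiteness comes
    first: \<open>renewal \<ge> 1\<close> dominates the indicator, and the fixed-point equation
    bounds the result by \<open>renewal x\<close>.\<close>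
  have "resolvent 1 (A x (indicator {y})) \<one> < \<infinity>" if "x \<in> E" "y \<in> E" for x y
  proof -
    have "resolvent 1 (A x (indicator {y})) \<one> \<le> resolvent 1 (A x renewal) \<one>"
      using renewal_fixpoint[OF \<open>y \<in> E\<close>]
      by (intro resolvent_mono kernel_op_mono) (auto simp: indicator_def)
    also have "\<dots> \<le> renewal x"
      using renewal_fixpoint[OF \<open>x \<in> E\<close>] by (simp add: ladder_op_eq)
    also have "\<dots> < \<infinity>" by (rule renewal_finite[OF \<open>x \<in> E\<close>])
    finally show ?thesis .
  qed
  then have ladder: "ennreal (ladder_kernel \<G> E p M X x y) = 1 * resolvent 1 (A x (indicator {y})) \<one>"
    if "x \<in> E" "y \<in> E" for x y
    using that by (simp add: ladder_kernel_def green shift_op_def)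
  have H_funpow: "(H.K ^^ n) \<phi> x = (ladder_op 1 ^^ n) \<phi> x" if "x \<in> E" for n \<phi> x
    unfolding ladder_op_def
    by (intro antisym funpow_kernel_kernel_mono that) (simp_all only: ladder order_refl)
  have V: "V (Some x) = renewal x" if "x \<in> E" for x
    using that by (simp add: V_def H.mean_absorption_time_eq H_funpow renewal_eq_suminf)
  have mean: "mean_absorption_time 1 M X x = g 1 x" if "x \<in> E" for x
    using that by (simp add: X.mean_absorption_time_eq resolvent_def)
  have surv: "survival_prob M X n x / survival_prob M X n \<one> = survival_ratio n x" if "x \<in> E" for n x
    using that by (simp add: X.survival_prob_eq survival_ratio_def survival_def)
  have trans: "transient_chain E N H"
    unfolding transient_chain_def
  proof (intro ballI)
    fix x y assume x: "x \<in> E" and y: "y \<in> E"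
    have "green N H x y = (\<Sum>n. (H.K ^^ n) (indicator {y}) x)"
      by (rule H.green_eq[OF x y])
    \<comment> \<open>Visits to one state are at most the total lifetime of the ladder process,
      whose mean is \<open>renewal x\<close>.\<close>
    also have "\<dots> \<le> (\<Sum>n. (H.K ^^ n) (\<lambda>_. 1) x)"
      by (intro suminf_le summableI funpow_kernel_mono x) (auto simp: indicator_def)
    also have "\<dots> = renewal x"
      by (simp add: H_funpow x renewal_eq_suminf)
    also have "\<dots> < \<infinity>" by (rule renewal_finite[OF x])
    finally show "green N H x y < \<infinity>" .
  qed
  have fin: "V z < \<infinity>" if "z \<in> completed E" for z
  proof -
    have "V None = 0" by (simp add: V_def)
    then show ?thesis using that renewal_finite by (auto simp: V)
  qed
  have one: "V (Some \<one>) = 1"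
    by (simp add: V renewal_one)
  have shift: "V (Some (x \<otimes> u))
      = V (Some x) + green_op E M X (shift_op \<G> E p u (\<lambda>y. V (Some y))) x"
    if "x \<in> E" "u \<in> E" for x u
  proof -
    have "shift_op \<G> E p u (\<lambda>y. V (Some y)) = A u renewal"
      unfolding shift_op_def by (intro ext kernel_op_cong V)
    then show ?thesis
      using that by (simp add: V green renewal_right_shift)
  qed
  have harm: "harmonic_function E p (\<lambda>x. V (Some x))"
    if "\<forall>x\<in>E. mean_absorption_time 1 M X x = \<infinity>"
  proof -
    have inf: "g 1 \<one> = \<infinity>" using that mean[of \<one>] by simp
    have "trans_op E p (\<lambda>x. V (Some x)) x = V (Some x)" if "x \<in> E" for x
    proof -
      have "trans_op E p (\<lambda>x. V (Some x)) x = P renewal x"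
        unfolding trans_op_def by (intro kernel_op_cong V)
      then show ?thesis using that by (simp add: V renewal_harmonic[OF inf])
    qed
    moreover have "\<exists>x\<in>E. V (Some x) \<noteq> 0"
      by (rule bexI[of _ \<one>]) (simp_all add: V renewal_one)
    ultimately show ?thesis
      using renewal_finite by (simp add: harmonic_function_def V)
  qed
  have lim: "(\<lambda>n. survival_prob M X n x / survival_prob M X n \<one>) \<longlonglongrightarrow> V (Some x)"
    if "\<forall>x\<in>E. mean_absorption_time 1 M X x = \<infinity>" "x \<in> E" for x
    using that mean[of \<one>] by (simp add: surv V survival_ratio_tendsto)
  have pot: "potential_function E M X (\<lambda>x. V (Some x))"
    if "\<forall>x\<in>E. mean_absorption_time 1 M X x < \<infinity>"
  proof -
    have g_fin: "g 1 \<one> < \<infinity>" using that mean[OF one_closed] by (metis one_closed)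
    \<comment> \<open>The density is the constant 1 / E_e(\<tau>), because the Green operator maps 1
      to the mean absorption time.\<close>
    have "V (Some x) = green_op E M X (\<lambda>_. inverse (g 1 \<one>)) x" if "x \<in> E" for x
      using that resolvent_cmult[OF that, of 1 "inverse (g 1 \<one>)" "\<lambda>_. 1"]
      by (simp add: V green renewal_eq_ratio[OF g_fin] divide_ennreal_def mult.commute)
    moreover have "inverse (g 1 \<one>) < \<infinity>"
      using g_ge_1[of \<one> 1] by (auto simp: less_top[symmetric])
    ultimately show ?thesis
      using renewal_finite unfolding potential_function_def by (metis V)
  qed
  have ratio: "V (Some x) = mean_absorption_time 1 M X x / mean_absorption_time 1 M X \<one>"
    if "\<forall>x\<in>E. mean_absorption_time 1 M X x < \<infinity>" "x \<in> E" for x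
  proof -
    have "g 1 \<one> < \<infinity>" using that(1) mean[OF one_closed] by (metis one_closed)
    then show ?thesis using that(2) by (simp only: V mean one_closed renewal_eq_ratio)
  qed
  have liminf: "V (Some x) \<le> liminf (\<lambda>n. survival_prob M X n x / survival_prob M X n \<one>)"
    if "x \<in> E" for x
    using that by (simp add: surv V renewal_le_liminf)
  show ?thesis
    by (intro conjI impI ballI; rule trans fin one shift harm lim pot ratio liminf; assumption)
qed

end
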